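(* Let $F=(f_1,\dots,f_n):\mathbb{R}^n\to\mathbb{R}^n$ be an everywhere defined real rational map with a nowhere vanishing Jacobian determinant, and let $d$ be the degree of the associated function field extension $\mathbb{R}(X)/\mathbb{R}(F)$. If $F$ is invertible, then $d$ is odd.
   Context: $\mathbb{R}(X)=\mathbb{R}(x_1,\dots,x_n)$ and $\mathbb{R}(F)=\mathbb{R}(f_1,\dots,f_n)\subseteq\mathbb{R}(X)$; the extension is of finite degree because the Jacobian determinant is not identically zero. An everywhere defined real rational map is one each of whose components can be written as a fraction of real polynomials with denominator vanishing nowhere on $\mathbb{R}^n$. "Invertible" means bijective as a map $\mathbb{R}^n\to\mathbb{R}^n$ (the inverse, which is then real analytic, is not required to be rational). *)

theory Defs
  imports
    "HOL-Analysis.Analysis"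
    "HOL-Library.Poly_Mapping"
    "HOL-Computational_Algebra.Fraction_Field"
    "HOL-Algebra.Generated_Fields"
    "HOL-Algebra.Algebraic_Closure_Type"
begin

text \<open>
  The variables are indexed by a finite type \<open>'n\<close>. The order on \<open>'n\<close> is needed only because the
  library's integral domain instance for polynomials (and hence the fraction field) requires it.
\<close>

type_synonym 'n real_mpoly = "('n \<Rightarrow>\<^sub>0 nat) \<Rightarrow>\<^sub>0 real"

type_synonym 'n real_ratfun = "'n real_mpoly fract"

definition mpoly_eval :: "'n::finite real_mpoly \<Rightarrow> real ^ 'n \<Rightarrow> real" where
  "mpoly_eval p x =
     (\<Sum>m\<in>Poly_Mapping.keys p.
        Poly_Mapping.lookup p m * (\<Prod>i\<in>UNIV. (x $ i) ^ Poly_Mapping.lookup m i))"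

text \<open>
  The denominator only has to be nonzero everywhere for one representation of \<open>r\<close> as a fraction.
  A nowhere vanishing \<open>q\<close> is a nonzero polynomial, so the junk value of \<open>Fract p 0\<close> plays no role,
  and \<open>r\<close> and \<open>\<phi>\<close> determine each other.
\<close>

definition everywhere_defined_as ::
    "'n::{finite,linorder} real_ratfun \<Rightarrow> (real ^ 'n::{finite,linorder} \<Rightarrow> real) \<Rightarrow> bool" where
  "everywhere_defined_as r \<phi> \<longleftrightarrow>
     (\<exists>p q. r = Fract p q \<and>
        (\<forall>x. mpoly_eval q x \<noteq> 0 \<and> \<phi> x = mpoly_eval p x / mpoly_eval q x))"

definition ratfun_const :: "real \<Rightarrow> 'n::{finite,linorder} real_ratfun" where
  "ratfun_const c = Fract (Poly_Mapping.single 0 c) 1"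

definition ratfun_field :: "'n::{finite,linorder} real_ratfun ring" where
  "ratfun_field = ring_of_type_algebra"

definition generated_ratfun_subfield ::
    "('n \<Rightarrow> 'n::{finite,linorder} real_ratfun) \<Rightarrow> 'n real_ratfun set" where
  "generated_ratfun_subfield f = generate_field ratfun_field (range ratfun_const \<union> range f)"

text \<open>
  \<open>ring.dim\<close> is unspecified for an extension of infinite degree, so nothing can be derived about
  this number without establishing finiteness.
\<close>

definition ratfun_extension_degree :: "('n \<Rightarrow> 'n::{finite,linorder} real_ratfun) \<Rightarrow> nat" where
  "ratfun_extension_degree f =
     ring.dim ratfun_field (generated_ratfun_subfield f) (carrier ratfun_field)"

end

theory Submission
  imports Defs
begin

text \<open>
  Put \<open>L = \<real>(X)\<close> and \<open>K = \<real>(F)\<close>. A rational function takes a real value at every point off a proper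
  hypersurface, so evaluation is a homomorphism \<open>\<sigma>\<close> from \<open>L\<close> to real-valued functions modulo equality at
  generic points. These behave like a real closed field, because real roots can be chosen pointwise.
  If \<open>[L : K]\<close> were even, \<open>\<sigma>\<close> restricted to \<open>K\<close> would have an extension \<open>\<tau>\<close> to \<open>L\<close> other than \<open>\<sigma>\<close>:
  climb from \<open>K\<close> to \<open>L\<close> by simple extensions, following \<open>\<sigma>\<close> up to the last step of even degree,
  where the root given by \<open>\<sigma>\<close> is simple and hence not the only real one; pick another root there and
  any root in the remaining steps, which have odd degree. With \<open>\<xi>(z) = (\<tau>(x\<^sub>1)(z), \<dots>, \<tau>(x\<^sub>n)(z))\<close> we get
  \<open>F(\<xi>(z)) = F(z)\<close> for generic \<open>z\<close>, so \<open>\<xi>(z) = z\<close> by injectivity and \<open>\<tau> = \<sigma>\<close>, a contradiction.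

  The degree is finite because \<open>F\<close> is surjective: this makes \<open>f\<^sub>1, \<dots>, f\<^sub>n\<close> algebraically independent, while
  counting monomials gives a nontrivial relation between \<open>x\<^sub>i\<close> and \<open>f\<^sub>1, \<dots>, f\<^sub>n\<close>.
\<close>

section \<open>Simple field extensions\<close>

hide_const (open) Polynomials.degree Polynomials.lead_coeff UnivPoly.monom UnivPoly.coeff

section \<open>A field type viewed as a ring of HOL-Algebra\<close>

abbreviation type_ring :: "'a::field ring" where "type_ring \<equiv> ring_of_type_algebra"

lemma type_ring_simps [simp]:
  "carrier (type_ring :: 'a::field ring) = UNIV"
  "x \<oplus>\<^bsub>type_ring\<^esub> y = x + y" "x \<otimes>\<^bsub>type_ring\<^esub> y = x * y"
  "\<zero>\<^bsub>type_ring\<^esub> = 0" "\<one>\<^bsub>type_ring\<^esub> = 1"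
  by (simp_all add: ring_of_type_algebra_def)

lemma type_ring_is_field: "Ring.field (type_ring :: 'a::field ring)"
  and type_ring_is_domain: "domain (type_ring :: 'a::field ring)"
  and type_ring_is_ring: "ring (type_ring :: 'a::field ring)"
  using field_from_type_algebra ring_from_type_algebra field.axioms(1) by blast+

lemma type_ring_minus [simp]: "\<ominus>\<^bsub>type_ring\<^esub> x = - x"
proof -
  interpret ring "type_ring :: 'a ring" by (rule type_ring_is_ring)
  show ?thesis
    by (rule minus_equality) simp_all
qed

lemma type_ring_inverse [simp]: "x \<noteq> 0 \<Longrightarrow> inv\<^bsub>type_ring\<^esub> x = inverse x"
proof -
  interpret domain "type_ring :: 'a ring" by (rule type_ring_is_domain)
  assume "x \<noteq> 0"
  thus ?thesis
    by (intro comm_inv_char) simp_all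
qed

lemma type_ring_power [simp]: "x [^]\<^bsub>type_ring\<^esub> (n::nat) = x ^ n"
proof -
  interpret ring "type_ring :: 'a ring" by (rule type_ring_is_ring)
  show ?thesis
    by (induction n) (simp_all add: mult.commute)
qed

lemma subfield_type_ring_closed:
  assumes "subfield E (type_ring :: 'a::field ring)"
  shows "0 \<in> E" "1 \<in> E" "a \<in> E \<Longrightarrow> b \<in> E \<Longrightarrow> a + b \<in> E" "a \<in> E \<Longrightarrow> - a \<in> E"
    "a \<in> E \<Longrightarrow> b \<in> E \<Longrightarrow> a * b \<in> E" "a \<in> E \<Longrightarrow> b \<in> E \<Longrightarrow> a - b \<in> E"
    "(\<And>i. i \<in> I \<Longrightarrow> g i \<in> E) \<Longrightarrow> sum g I \<in> E" "a \<in> E \<Longrightarrow> of_nat n * a \<in> E"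
proof -
  note E = subfieldE(1)[OF assms]
  show 0: "0 \<in> E" and 1: "1 \<in> E"
    using subringE(2,3)[OF E] by simp_all
  show add: "a \<in> E \<Longrightarrow> b \<in> E \<Longrightarrow> a + b \<in> E" for a b
    using subringE(7)[OF E, of a b] by simp
  show neg: "a \<in> E \<Longrightarrow> - a \<in> E" for a
    using subringE(5)[OF E, of a] by simp
  show mult: "a \<in> E \<Longrightarrow> b \<in> E \<Longrightarrow> a * b \<in> E" for a b
    using subringE(6)[OF E, of a b] by simp
  show "a \<in> E \<Longrightarrow> b \<in> E \<Longrightarrow> a - b \<in> E"
    using add[of a "- b"] neg[of b] by simp
  show "(\<And>i. i \<in> I \<Longrightarrow> g i \<in> E) \<Longrightarrow> sum g I \<in> E"
    by (induction I rule: infinite_finite_induct) (use 0 add in auto)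
  have "of_nat n \<in> E"
    by (induction n) (use 0 1 add in auto)
  thus "a \<in> E \<Longrightarrow> of_nat n * a \<in> E"
    by (rule mult)
qed

section \<open>Polynomials with coefficients in a subfield\<close>

definition polys_over :: "'a::zero set \<Rightarrow> 'a poly set" where
  "polys_over E = {p. \<forall>i. coeff p i \<in> E}"

lemma polys_overD: "p \<in> polys_over E \<Longrightarrow> coeff p i \<in> E"
  by (simp add: polys_over_def)

lemma polys_over_UNIV [simp]: "polys_over UNIV = UNIV"
  by (simp add: polys_over_def)

lemma polys_over_closed:
  assumes "subfield E (type_ring :: 'a::field ring)"
  shows "0 \<in> polys_over E" "1 \<in> polys_over E"
    "p \<in> polys_over E \<Longrightarrow> q \<in> polys_over E \<Longrightarrow> p + q \<in> polys_over E"
    "p \<in> polys_over E \<Longrightarrow> q \<in> polys_over E \<Longrightarrow> p - q \<in> polys_over E"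
    "p \<in> polys_over E \<Longrightarrow> q \<in> polys_over E \<Longrightarrow> p * q \<in> polys_over E"
    "c \<in> E \<Longrightarrow> p \<in> polys_over E \<Longrightarrow> pCons c p \<in> polys_over E"
    "c \<in> E \<Longrightarrow> monom c n \<in> polys_over E"
    "p \<in> polys_over E \<Longrightarrow> pderiv p \<in> polys_over E"
  using subfield_type_ring_closed[OF assms]
  by (auto simp: polys_over_def coeff_mult coeff_pCons coeff_pderiv split: nat.split simp del: of_nat_Suc
      intro!: subfield_type_ring_closed(7)[OF assms])

text \<open>HOL-Algebra lists coefficients from the highest down, \<open>Poly\<close> from the
  constant term up; hence \<open>rev\<close> in all translations between the two kinds of
  polynomials.\<close>

lemma type_ring_eval: "ring.eval type_ring xs a = poly (Poly (rev xs)) a"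
proof (induction xs)
  case Nil
  show ?case
    by (simp add: ring.eval.simps[OF type_ring_is_ring])
next
  case (Cons x xs)
  show ?case
    by (simp add: ring.eval.simps[OF type_ring_is_ring] Cons.IH Poly_append poly_monom algebra_simps)
qed

lemma rev_coeffs_carrier:
  assumes "p \<in> polys_over E"
  shows "rev (coeffs p) \<in> carrier (univ_poly (type_ring :: 'a::field ring) E)"
proof -
  have "set (coeffs p) \<subseteq> E"
    using assms by (auto simp: polys_over_def coeffs_def)
  moreover have "hd (rev (coeffs p)) \<noteq> 0" if "p \<noteq> 0"
    using that by (simp add: hd_rev last_coeffs_eq_coeff_degree)
  ultimately show ?thesis
    by (auto simp: univ_poly_def polynomial_def)
qed

lemma Poly_rev_polys_over:
  assumes "subfield E type_ring" "xs \<in> carrier (univ_poly (type_ring :: 'a::field ring) E)"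
  shows "Poly (rev xs) \<in> polys_over E"
proof -
  have "set xs \<subseteq> E"
    using assms(2) by (auto simp: univ_poly_def polynomial_def)
  thus ?thesis
    using subfield_type_ring_closed(1)[OF assms(1)]
    by (auto simp: polys_over_def nth_default_def rev_nth)
qed

lemma simple_extension_type_ring:
  assumes "subfield E type_ring"
  shows "ring.simple_extension type_ring E a = {poly p a | p. p \<in> polys_over E}"
proof -
  interpret domain "type_ring :: 'a ring" by (rule type_ring_is_domain)
  have "poly (Poly (rev xs)) a \<in> {poly p a | p. p \<in> polys_over E}"
    if "xs \<in> carrier (univ_poly type_ring E)" for xs
    using Poly_rev_polys_over[OF assms that] by blast
  moreover have "poly p a \<in> (\<lambda>xs. poly (Poly (rev xs)) a) ` carrier (univ_poly type_ring E)"
    if "p \<in> polys_over E" for p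
    using rev_coeffs_carrier[OF that] by (intro image_eqI[where x = "rev (coeffs p)"]) simp_all
  ultimately show ?thesis
    unfolding simple_extension_as_eval_img[OF subfieldE(3)[OF assms], of a, simplified] type_ring_eval
    by auto
qed

lemma algebraic_type_ringI:
  assumes "p \<in> polys_over E" "p \<noteq> 0" "poly p a = 0"
  shows "(ring.algebraic (type_ring :: 'a::field ring) over E) a"
proof -
  interpret domain "type_ring :: 'a ring" by (rule type_ring_is_domain)
  show ?thesis
    using rev_coeffs_carrier[OF assms(1)] assms(2,3)
    by (intro algebraicI[of "rev (coeffs p)"]) (simp_all add: type_ring_eval)
qed

text \<open>Carries the minimal polynomial \<open>Irr E a\<close>, a coefficient list, over to the
  type \<open>poly\<close>, where derivatives and \<open>map_poly\<close> are at hand. The degree of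
  a list is its length minus one.\<close>

lemma simple_extension_minimal_poly:
  fixes a :: "'a::field"
  assumes E: "subfield E type_ring" and alg: "(ring.algebraic type_ring over E) a"
  obtains m E' where "m \<in> polys_over E" "lead_coeff m = 1" "poly m a = 0"
    "\<And>p. p \<in> polys_over E \<Longrightarrow> p \<noteq> 0 \<Longrightarrow> poly p a = 0 \<Longrightarrow> degree m \<le> degree p"
    "E' = {poly p a | p. p \<in> polys_over E}" "subfield E' type_ring"
    "ring.dimension type_ring (degree m) E E'"
proof -
  interpret domain "type_ring :: 'a ring" by (rule type_ring_is_domain)
  define xs where "xs = Irr E a"
  note Irr = IrrE[OF E _ alg, simplified, folded xs_def]
  have "xs \<noteq> []"
    using Irr(2) by (auto simp: ring_irreducible_def univ_poly_def)
  define m where "m = Poly (rev xs)"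
  have coeffs_m: "coeffs m = rev xs"
    unfolding m_def using Irr(3) \<open>xs \<noteq> []\<close> by (cases xs) simp_all
  have "degree m = length xs - 1"
    by (metis coeffs_m degree_eq_length_coeffs length_rev)
  show ?thesis
  proof
    show "m \<in> polys_over E"
      unfolding m_def using Poly_rev_polys_over[OF E Irr(1)] .
    show "lead_coeff m = 1"
      using Irr(3) \<open>xs \<noteq> []\<close> coeffs_m by (metis coeffs_eq_Nil last_coeffs_eq_coeff_degree last_rev rev_is_Nil_conv)
    show "poly m a = 0"
      using Irr(4) by (simp add: type_ring_eval m_def)
    show "degree m \<le> degree p" if "p \<in> polys_over E" "p \<noteq> 0" "poly p a = 0" for p
    proof -
      have "Polynomials.degree xs \<le> Polynomials.degree (rev (coeffs p))"
        unfolding xs_def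
      proof (rule pdivides_imp_degree_le[OF subfieldE(1)[OF E] _ _ _ Irr_minimal[OF E _ alg]])
        show "Irr E a \<in> carrier (univ_poly type_ring E)"
          using Irr(1) by (simp add: xs_def)
      qed (use that rev_coeffs_carrier[OF that(1)] in \<open>simp_all add: type_ring_eval\<close>)
      thus ?thesis
        using \<open>degree m = _\<close> by (simp add: degree_eq_length_coeffs)
    qed
    show "simple_extension E a = {poly p a | p. p \<in> polys_over E}"
      by (rule simple_extension_type_ring[OF E])
    show "subfield (simple_extension E a) type_ring"
      using simple_extension_is_subfield[OF E] alg by simp
    show "dimension (degree m) E (simple_extension E a)"
      using dimension_simple_extension[OF E _ alg] \<open>degree m = _\<close> by (simp add: xs_def)
  qed
qed

section \<open>Steps of a tower of simple extensions\<close>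

lemma finite_dimension_over_larger_field:
  assumes "subfield E type_ring" "subfield E' type_ring" "E \<subseteq> E'"
    and "ring.finite_dimension (type_ring :: 'a::field ring) E UNIV"
  shows "ring.finite_dimension type_ring E' UNIV"
proof -
  interpret domain "type_ring :: 'a ring" by (rule type_ring_is_domain)
  obtain Vs where "Span E Vs = UNIV"
    using assms(4) exists_base[OF assms(1)] by blast
  moreover have "Span E Vs \<subseteq> Span E' Vs"
    using assms(3) by (auto simp: Span_eq_combine_set[OF assms(1)] Span_eq_combine_set[OF assms(2)] simp del: Span.simps)
  ultimately show ?thesis
    using Span_finite_dimension[OF assms(2), of Vs] by (metis subset_UNIV subset_antisym type_ring_simps(1))
qed

lemma poly_in_subfield:
  assumes "subfield E (type_ring :: 'a::field ring)" "p \<in> polys_over E" "a \<in> E"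
  shows "poly p a \<in> E"
proof -
  have "a ^ i \<in> E" for i
    by (induction i) (use subfield_type_ring_closed[OF assms(1)] assms(3) in auto)
  thus ?thesis
    using assms(2) subfield_type_ring_closed[OF assms(1)]
    by (auto simp: poly_altdef polys_over_def intro!: subfield_type_ring_closed(7)[OF assms(1)])
qed

text \<open>A monic polynomial of degree 0 has no root, and the root of one of degree 1 is the
  negative of its constant term, hence in \<open>E\<close>.\<close>

lemma degree_minimal_poly_gt_1:
  assumes E: "subfield E (type_ring :: 'a::field ring)"
    and m: "m \<in> polys_over E" "lead_coeff m = 1" "poly m a = 0" and a: "a \<notin> E"
  shows "1 < degree m"
proof (rule ccontr)
  assume "\<not> 1 < degree m"
  then consider "degree m = 0" | "degree m = 1"
    by linarith
  thus False
  proof cases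
    case 1
    thus ?thesis
      using m(2,3) by (simp add: poly_altdef)
  next
    case 2
    hence "a = - coeff m 0"
      using m(2,3) by (simp add: poly_altdef eq_neg_iff_add_eq_0 add.commute)
    thus ?thesis
      using a polys_overD[OF m(1)] subfield_type_ring_closed(4)[OF E] by blast
  qed
qed

text \<open>Polynomial division inside \<open>polys_over E\<close>: as \<open>m\<close> is monic,
  the quotient needs no inverses, and minimality keeps the process going until the remainder is
  zero.\<close>

lemma minimal_poly_dvd:
  assumes E: "subfield E (type_ring :: 'a::field ring)"
    and m: "m \<in> polys_over E" "lead_coeff m = 1" "poly m a = 0"
    and min: "\<And>p. p \<in> polys_over E \<Longrightarrow> p \<noteq> 0 \<Longrightarrow> poly p a = 0 \<Longrightarrow> degree m \<le> degree p"
    and p: "p \<in> polys_over E" "poly p a = 0"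
  shows "\<exists>q\<in>polys_over E. p = m * q"
  using p
proof (induction "degree p" arbitrary: p rule: less_induct)
  case less
  show ?case
  proof (cases "p = 0")
    case True
    thus ?thesis
      using polys_over_closed(1)[OF E] by (intro bexI[of _ 0]) auto
  next
    case False
    \<comment> \<open>Chosen so that \<open>m * t\<close> has the degree and the leading coefficient
      of \<open>p\<close>; the difference still vanishes at \<open>a\<close>.\<close>
    define t where "t = monom (lead_coeff p) (degree p - degree m)"
    define p' where "p' = p - m * t"
    have le: "degree m \<le> degree p"
      by (rule min[OF less.prems(1) False less.prems(2)])
    have t: "t \<in> polys_over E"
      unfolding t_def using polys_overD[OF less.prems(1)] by (rule polys_over_closed(7)[OF E])
    have p': "p' \<in> polys_over E" "poly p' a = 0"
      unfolding p'_def using less.prems t m(1,3) by (auto intro!: polys_over_closed(4,5)[OF E])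
    have "degree (m * t) = degree p" "coeff (m * t) (degree p) = lead_coeff p"
    proof -
      have "m \<noteq> 0" "t \<noteq> 0"
        using m(2) False by (auto simp: t_def)
      thus deg: "degree (m * t) = degree p"
        using le False by (simp add: degree_mult_eq t_def degree_monom_eq)
      show "coeff (m * t) (degree p) = lead_coeff p"
        using lead_coeff_mult[of m t] m(2) by (simp only: deg) (simp add: t_def degree_monom_eq False)
    qed
    hence "p' = 0 \<or> degree p' < degree p"
      unfolding p'_def by (intro eq_zero_or_degree_less degree_diff_le) auto
    hence "\<exists>q\<in>polys_over E. p' = m * q"
      using less.hyps[OF _ p'] polys_over_closed(1)[OF E] by (metis mult_zero_right)
    then obtain q where "q \<in> polys_over E" "p' = m * q"
      by blast
    thus ?thesis
      using t by (intro bexI[of _ "q + t"]) (auto simp: p'_def algebra_simps intro: polys_over_closed(3)[OF E])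
  qed
qed

text \<open>Adjoins an arbitrary \<open>a\<close> outside \<open>E\<close>. The tower law gives
  \<open>n = degree m * n'\<close>, which carries the parity, and \<open>n' < n\<close> drives the
  inductions on the dimension.\<close>

lemma proper_extension_step:
  assumes E: "subfield E (type_ring :: 'a::field ring)" and dim: "ring.dimension type_ring n E UNIV"
    and proper: "E \<noteq> UNIV"
  obtains a m E' n' where "m \<in> polys_over E" "lead_coeff m = 1" "poly m a = 0"
    "\<And>p. p \<in> polys_over E \<Longrightarrow> p \<noteq> 0 \<Longrightarrow> poly p a = 0 \<Longrightarrow> degree m \<le> degree p"
    "E' = {poly p a | p. p \<in> polys_over E}" "subfield E' type_ring"
    "1 < degree m" "n = degree m * n'" "n' < n" "ring.dimension type_ring n' E' UNIV"
proof -
  interpret domain "type_ring :: 'a ring" by (rule type_ring_is_domain)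
  obtain a where a: "a \<notin> E"
    using proper by blast
  have findim: "finite_dimension E UNIV"
    by (rule finite_dimensionI[OF dim])
  have "(algebraic over E) a"
    using finite_dimension_imp_algebraic[OF E carrier_is_subring] findim by simp
  then obtain m E' where m: "m \<in> polys_over E" "lead_coeff m = 1" "poly m a = 0"
    "\<And>p. p \<in> polys_over E \<Longrightarrow> p \<noteq> 0 \<Longrightarrow> poly p a = 0 \<Longrightarrow> degree m \<le> degree p"
    "E' = {poly p a | p. p \<in> polys_over E}" "subfield E' type_ring"
    "dimension (degree m) E E'"
    by (elim simple_extension_minimal_poly[OF E, of a thesis for thesis]) (rule that, assumption+)
  have "E \<subseteq> E'"
  proof
    fix e assume "e \<in> E"
    hence "[:e:] \<in> polys_over E"
      using polys_over_closed(1,6)[OF E] by blast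
    thus "e \<in> E'"
      unfolding m(5) by force
  qed
  then obtain n' where n': "dimension n' E' UNIV"
    using finite_dimension_over_larger_field[OF E m(6) _ findim] by blast
  have "n = degree m * n'"
    using telescopic_base[OF E m(6,7) n'] dim dimension_is_inj[OF E] by blast
  moreover have "1 < degree m"
    by (rule degree_minimal_poly_gt_1[OF E m(1-3) a])
  moreover have "n' \<noteq> 0"
  proof
    assume "n' = 0"
    hence "UNIV = {0 :: 'a}"
      using dimension_zero[OF m(6)] n' by simp
    hence "(1 :: 'a) \<in> {0}"
      by blast
    thus False
      by simp
  qed
  ultimately have "n' < n"
    by simp
  show ?thesis
    by (rule that[OF m(1-6) \<open>1 < degree m\<close> \<open>n = degree m * n'\<close> \<open>n' < n\<close> n'])
qed

section \<open>Homomorphisms to real functions modulo a filter\<close>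

lemma odd_degree_imp_real_root:
  fixes p :: "real poly"
  assumes "odd (degree p)"
  shows "\<exists>x. poly p x = 0"
proof -
  have *: "\<exists>x. poly p x = 0" if p: "odd (degree p)" "lead_coeff p > 0" for p :: "real poly"
  proof -
    have pos: "\<exists>u. poly r u > 0" if "lead_coeff r > 0" for r :: "real poly"
    proof -
      from poly_pinfty_gt_lc[OF that] obtain n where "\<forall>x\<ge>n. lead_coeff r \<le> poly r x"
        by blast
      with that have "poly r n > 0"
        by (metis less_le_trans order_refl)
      thus ?thesis ..
    qed
    from pos[OF p(2)] obtain u where u: "poly p u > 0" ..
    \<comment> \<open>For odd degree, -p(-x) has the same leading coefficient as p(x), so a positive
      value of \<open>q\<close> at \<open>v\<close> gives a negative value of \<open>p\<close> at
      \<open>-v\<close>.\<close>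
    define q where "q = - pcompose p [:0, -1:]"
    have "lead_coeff q = lead_coeff p"
      using p(1) unfolding q_def by (simp add: lead_coeff_comp uminus_power_if)
    with pos[of q] p(2) obtain v where v: "poly q v > 0"
      by auto
    have "poly p (-v) < 0"
      using v by (simp add: q_def poly_pcompose)
    thus ?thesis
      using u poly_IVT_neg[of u "-v" p] poly_IVT_pos[of "-v" u p]
      by (cases u "-v" rule: linorder_cases) auto
  qed
  show ?thesis
  proof (cases "lead_coeff p > 0")
    case False
    thus ?thesis
      using *[of "-p"] assms by (cases "p = 0") (auto simp: linorder_not_less order_le_less)
  qed (use * assms in blast)
qed

text \<open>Splitting off the root \<open>r\<close> leaves a factor of odd degree. It has a real
  root, which differs from \<open>r\<close> because \<open>r\<close> is simple.\<close>

lemma even_degree_imp_other_root: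
  fixes p :: "real poly"
  assumes "even (degree p)" "poly p r = 0" "poly (pderiv p) r \<noteq> 0"
  shows "\<exists>x. poly p x = 0 \<and> x \<noteq> r"
proof -
  obtain q where q: "p = [:-r, 1:] * q"
    using assms(2) by (auto simp: poly_eq_0_iff_dvd)
  have "q \<noteq> 0"
    using assms(3) q by auto
  hence "degree p = Suc (degree q)"
    unfolding q by (subst degree_mult_eq) auto
  then obtain x where x: "poly q x = 0"
    using assms(1) odd_degree_imp_real_root[of q] by auto
  have "poly q r \<noteq> 0"
    using assms(3) unfolding q pderiv_mult by (simp add: pderiv_pCons)
  thus ?thesis
    using x q by (intro exI[of _ x]) auto
qed

section \<open>Laws of a homomorphism that hold at generic arguments\<close>

text \<open>
  The laws hold on a set of \<open>G\<close> that depends on the arguments; this stands for a homomorphism into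
  functions modulo \<open>G\<close> and avoids both the quotient and an ultrafilter.
\<close>

definition eventual_hom :: "'z filter \<Rightarrow> 'a::field set \<Rightarrow> ('a \<Rightarrow> 'z \<Rightarrow> real) \<Rightarrow> bool" where
  "eventual_hom G E \<tau> \<longleftrightarrow> (\<forall>\<^sub>F z in G. \<tau> 1 z = 1) \<and>
     (\<forall>a\<in>E. \<forall>b\<in>E. \<forall>\<^sub>F z in G. \<tau> (a + b) z = \<tau> a z + \<tau> b z) \<and>
     (\<forall>a\<in>E. \<forall>b\<in>E. \<forall>\<^sub>F z in G. \<tau> (a * b) z = \<tau> a z * \<tau> b z)"

lemma eventual_hom_mono: "eventual_hom G E \<tau> \<Longrightarrow> E' \<subseteq> E \<Longrightarrow> eventual_hom G E' \<tau>"
  unfolding eventual_hom_def by blast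

locale eventual_field_hom =
  fixes G :: "'z filter" and E :: "'a::field_char_0 set" and \<tau> :: "'a \<Rightarrow> 'z \<Rightarrow> real"
  assumes subfield: "subfield E type_ring" and eventual_hom: "eventual_hom G E \<tau>"
begin

abbreviation apply_poly :: "'a poly \<Rightarrow> 'z \<Rightarrow> real poly" where
  "apply_poly p z \<equiv> map_poly (\<lambda>c. \<tau> c z) p"

lemma one: "\<forall>\<^sub>F z in G. \<tau> 1 z = 1"
  and add: "a \<in> E \<Longrightarrow> b \<in> E \<Longrightarrow> \<forall>\<^sub>F z in G. \<tau> (a + b) z = \<tau> a z + \<tau> b z"
  and mult: "a \<in> E \<Longrightarrow> b \<in> E \<Longrightarrow> \<forall>\<^sub>F z in G. \<tau> (a * b) z = \<tau> a z * \<tau> b z"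
  using eventual_hom by (auto simp: eventual_hom_def)

text \<open>The rules for \<open>map_poly\<close> require 0 to be mapped to 0. Here this is true
  only eventually, so the fact enters every argument about \<open>apply_poly\<close>.\<close>

lemma zero: "\<forall>\<^sub>F z in G. \<tau> 0 z = 0"
  using add[of 0 0] subfield_type_ring_closed(1)[OF subfield] by simp

text \<open>The values of \<open>a\<close> and of its inverse eventually have product 1.\<close>

lemma nonzero:
  assumes "a \<in> E" "inverse a \<in> E" "a \<noteq> 0"
  shows "\<forall>\<^sub>F z in G. \<tau> a z \<noteq> 0"
  using mult[OF assms(1,2)] one by eventually_elim (use assms(3) in auto)

lemma sum:
  assumes "finite S" "\<And>s. s \<in> S \<Longrightarrow> g s \<in> E"
  shows "\<forall>\<^sub>F z in G. \<tau> (\<Sum>s\<in>S. g s) z = (\<Sum>s\<in>S. \<tau> (g s) z)"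
  using assms
proof (induction S)
  case empty
  show ?case using zero by simp
next
  case (insert s S)
  have "\<forall>\<^sub>F z in G. \<tau> (g s + (\<Sum>s\<in>S. g s)) z = \<tau> (g s) z + \<tau> (\<Sum>s\<in>S. g s) z"
    using insert.prems by (intro add subfield_type_ring_closed(7)[OF subfield]) auto
  moreover have "\<forall>\<^sub>F z in G. \<tau> (\<Sum>s\<in>S. g s) z = (\<Sum>s\<in>S. \<tau> (g s) z)"
    using insert.IH insert.prems by blast
  ultimately show ?case
    by eventually_elim (use insert.hyps in auto)
qed

lemma of_nat_mult:
  assumes "a \<in> E"
  shows "\<forall>\<^sub>F z in G. \<tau> (of_nat n * a) z = of_nat n * \<tau> a z"
  using sum[of "{..<n}" "\<lambda>_. a"] assms by simp

lemma prod:
  assumes "finite S" "\<And>s. s \<in> S \<Longrightarrow> g s \<in> E"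
  shows "\<forall>\<^sub>F z in G. \<tau> (\<Prod>s\<in>S. g s) z = (\<Prod>s\<in>S. \<tau> (g s) z)"
  using assms
proof (induction S)
  case empty
  show ?case using one by simp
next
  case (insert s S)
  have "(\<Prod>s\<in>S. g s) \<in> E"
    using insert.hyps(1) insert.prems
    by (induction S) (use subfield_type_ring_closed(2,5)[OF subfield] in auto)
  hence "\<forall>\<^sub>F z in G. \<tau> (g s * (\<Prod>s\<in>S. g s)) z = \<tau> (g s) z * \<tau> (\<Prod>s\<in>S. g s) z"
    using insert.prems by (intro mult) auto
  moreover have "\<forall>\<^sub>F z in G. \<tau> (\<Prod>s\<in>S. g s) z = (\<Prod>s\<in>S. \<tau> (g s) z)"
    using insert.IH insert.prems by blast
  ultimately show ?case
    by eventually_elim (use insert.hyps in auto)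
qed

lemma power:
  assumes "a \<in> E"
  shows "\<forall>\<^sub>F z in G. \<tau> (a ^ n) z = \<tau> a z ^ n"
  using prod[of "{..<n}" "\<lambda>_. a"] assms by simp

text \<open>Equality of polynomials is reduced to finitely many coefficient equations, each of which
  holds eventually; beyond the degrees all coefficients are \<open>\<tau> 0 z = 0\<close>.\<close>

lemma apply_poly_add:
  assumes "p \<in> polys_over E" "q \<in> polys_over E"
  shows "\<forall>\<^sub>F z in G. apply_poly (p + q) z = apply_poly p z + apply_poly q z"
proof -
  have "\<forall>\<^sub>F z in G. \<forall>i\<in>{..max (degree p) (degree q)}.
      \<tau> (coeff p i + coeff q i) z = \<tau> (coeff p i) z + \<tau> (coeff q i) z"
    using assms by (intro eventually_ball_finite ballI add polys_overD) auto
  with zero show ?thesis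
  proof eventually_elim
    case (elim z)
    show ?case
    proof (rule poly_eqI)
      fix i
      show "coeff (apply_poly (p + q) z) i = coeff (apply_poly p z + apply_poly q z) i"
        using elim by (cases "i \<le> max (degree p) (degree q)") (auto simp: coeff_map_poly coeff_eq_0)
    qed
  qed
qed

lemma apply_poly_mult:
  assumes "p \<in> polys_over E" "q \<in> polys_over E"
  shows "\<forall>\<^sub>F z in G. apply_poly (p * q) z = apply_poly p z * apply_poly q z"
proof -
  have "\<forall>\<^sub>F z in G. \<forall>i\<in>{..degree p + degree q}.
      \<tau> (\<Sum>j\<le>i. coeff p j * coeff q (i - j)) z = (\<Sum>j\<le>i. \<tau> (coeff p j * coeff q (i - j)) z)"
    using assms
    by (intro eventually_ball_finite ballI sum) (auto intro!: subfield_type_ring_closed(5)[OF subfield] polys_overD)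
  moreover have "\<forall>\<^sub>F z in G. \<forall>i\<in>{..degree p + degree q}. \<forall>j\<in>{..i}.
      \<tau> (coeff p j * coeff q (i - j)) z = \<tau> (coeff p j) z * \<tau> (coeff q (i - j)) z"
    using assms by (intro eventually_ball_finite ballI mult polys_overD) auto
  ultimately show ?thesis
    using zero
  proof eventually_elim
    case (elim z)
    show ?case
    proof (rule poly_eqI)
      fix i
      show "coeff (apply_poly (p * q) z) i = coeff (apply_poly p z * apply_poly q z) i"
      proof (cases "i \<le> degree p + degree q")
        case True
        thus ?thesis
          using elim by (simp add: coeff_map_poly coeff_mult)
      next
        case False
        have "degree (apply_poly p z) \<le> degree p" "degree (apply_poly q z) \<le> degree q"
          using elim(3) by (auto intro!: degree_le simp: coeff_map_poly coeff_eq_0)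
        hence "degree (apply_poly p z * apply_poly q z) < i" "degree (p * q) < i"
          using False degree_mult_le[of p q] degree_mult_le[of "apply_poly p z" "apply_poly q z"] by linarith+
        thus ?thesis
          using elim(3) by (simp add: coeff_map_poly coeff_eq_0)
      qed
    qed
  qed
qed

lemma apply_poly_pderiv:
  assumes "p \<in> polys_over E"
  shows "\<forall>\<^sub>F z in G. apply_poly (pderiv p) z = pderiv (apply_poly p z)"
proof -
  have "\<forall>\<^sub>F z in G. \<forall>i\<in>{..degree p}.
      \<tau> (of_nat (Suc i) * coeff p (Suc i)) z = of_nat (Suc i) * \<tau> (coeff p (Suc i)) z"
    using assms by (intro eventually_ball_finite ballI of_nat_mult polys_overD) auto
  with zero show ?thesis
  proof eventually_elim
    case (elim z)
    show ?case
    proof (rule poly_eqI)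
      fix i
      show "coeff (apply_poly (pderiv p) z) i = coeff (pderiv (apply_poly p z)) i"
        using elim by (cases "i \<le> degree p")
          (auto simp: coeff_map_poly coeff_eq_0 coeff_pderiv simp del: of_nat_Suc)
    qed
  qed
qed

lemma poly_apply_poly:
  assumes "p \<in> polys_over E" "a \<in> E"
  shows "\<forall>\<^sub>F z in G. \<tau> (poly p a) z = poly (apply_poly p z) (\<tau> a z)"
  using assms(1)
proof (induction p)
  case 0
  show ?case
    using zero by simp
next
  case (pCons c p)
  have c: "c \<in> E" and p: "p \<in> polys_over E"
    using polys_overD[OF pCons.prems, of 0] polys_overD[OF pCons.prems, of "Suc _"]
    by (auto simp: polys_over_def)
  have pa: "poly p a \<in> E"
    by (rule poly_in_subfield[OF subfield p assms(2)])
  have "a * poly p a \<in> E"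
    by (rule subfield_type_ring_closed(5)[OF subfield assms(2) pa])
  from add[OF c this] mult[OF assms(2) pa] pCons.IH[OF p] zero show ?case
    by eventually_elim (simp add: map_poly_pCons)
qed

text \<open>The leading coefficient 1 is eventually mapped to 1. This lets the parity of the degree
  survive the passage to real polynomials.\<close>

lemma degree_apply_poly:
  assumes "lead_coeff p = 1"
  shows "\<forall>\<^sub>F z in G. degree (apply_poly p z) = degree p"
  using zero one
proof eventually_elim
  case (elim z)
  show ?case
  proof (rule antisym)
    show "degree (apply_poly p z) \<le> degree p"
      using elim by (auto intro!: degree_le simp: coeff_map_poly coeff_eq_0)
    show "degree p \<le> degree (apply_poly p z)"
      using elim assms by (intro le_degree) (simp add: coeff_map_poly)
  qed
qed

end

text \<open>The universal property of E[X]/(m): \<open>p(a)\<close> is sent to the value at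
  \<open>t z\<close> of the image of \<open>p\<close>. Two polynomials with the same value at
  \<open>a\<close> differ by a multiple of \<open>m\<close>, whose image eventually vanishes at
  \<open>t z\<close>.\<close>

lemma eventual_hom_extend:
  fixes E :: "'a::field_char_0 set"
  assumes E: "subfield E type_ring" and hom: "eventual_hom G E \<tau>"
    and m: "m \<in> polys_over E" "lead_coeff m = 1" "poly m a = 0"
    and min: "\<And>p. p \<in> polys_over E \<Longrightarrow> p \<noteq> 0 \<Longrightarrow> poly p a = 0 \<Longrightarrow> degree m \<le> degree p"
    and E': "E' = {poly p a | p. p \<in> polys_over E}"
    and root: "\<forall>\<^sub>F z in G. poly (map_poly (\<lambda>c. \<tau> c z) m) (t z) = 0"
  shows "\<exists>\<tau>'. eventual_hom G E' \<tau>' \<and> (\<forall>e\<in>E. \<forall>\<^sub>F z in G. \<tau>' e z = \<tau> e z) \<and>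
           (\<forall>\<^sub>F z in G. \<tau>' a z = t z)"
proof -
  interpret eventual_field_hom G E \<tau>
    by (rule eventual_field_hom.intro[OF E hom])
  note closed = polys_over_closed[OF E]
  \<comment> \<open>An arbitrary choice of representative; the fact \<open>\<tau>'\<close> below
    shows that any other one gives eventually the same value.\<close>
  define rep where "rep x = (SOME p. p \<in> polys_over E \<and> poly p a = x)" for x
  define \<tau>' where "\<tau>' x z = poly (apply_poly (rep x) z) (t z)" for x z
  have rep: "rep (poly p a) \<in> polys_over E" "poly (rep (poly p a)) a = poly p a"
    if "p \<in> polys_over E" for p
    using someI[of "\<lambda>q. q \<in> polys_over E \<and> poly q a = poly p a" p] that by (auto simp: rep_def)
  have \<tau>': "\<forall>\<^sub>F z in G. \<tau>' (poly p a) z = poly (apply_poly p z) (t z)" if p: "p \<in> polys_over E" for p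
  proof -
    define r where "r = rep (poly p a)"
    have r: "r \<in> polys_over E" "poly r a = poly p a"
      using rep[OF p] by (simp_all add: r_def)
    have "r - p \<in> polys_over E" "poly (r - p) a = 0"
      using closed(4) r p by auto
    then obtain q where q: "q \<in> polys_over E" "r - p = m * q"
      using minimal_poly_dvd[OF E m min] by blast
    have "r = p + m * q"
      using q(2) by (simp add: algebra_simps)
    with apply_poly_add[OF p closed(5)[OF m(1) q(1)]]
    have "\<forall>\<^sub>F z in G. apply_poly r z = apply_poly p z + apply_poly (m * q) z"
      by simp
    with apply_poly_mult[OF m(1) q(1)] root show ?thesis
      by eventually_elim (simp add: \<tau>'_def flip: r_def)
  qed
  show ?thesis
  proof (intro exI[of _ \<tau>'] conjI ballI)
    show 1: "\<forall>\<^sub>F z in G. \<tau>' e z = \<tau> e z" if "e \<in> E" for e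
    proof -
      have "[:e:] \<in> polys_over E"
        using that closed(1,6) by blast
      from \<tau>'[OF this] zero show ?thesis
        by eventually_elim (simp add: map_poly_pCons)
    qed
    have "[:0, 1:] \<in> polys_over E"
      using subfield_type_ring_closed(1,2)[OF E] closed(1,6) by blast
    from \<tau>'[OF this] zero one show "\<forall>\<^sub>F z in G. \<tau>' a z = t z"
      by eventually_elim (simp add: map_poly_pCons)
    show "eventual_hom G E' \<tau>'"
      unfolding eventual_hom_def
    proof (intro conjI ballI)
      from 1[OF subfield_type_ring_closed(2)[OF E]] one show "\<forall>\<^sub>F z in G. \<tau>' 1 z = 1"
        by eventually_elim simp
    next
      fix x y assume "x \<in> E'" "y \<in> E'"
      then obtain p q where p: "p \<in> polys_over E" "x = poly p a" and q: "q \<in> polys_over E" "y = poly q a"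
        unfolding E' by blast
      from \<tau>'[OF p(1)] \<tau>'[OF q(1)] \<tau>'[OF closed(3)[OF p(1) q(1)]] apply_poly_add[OF p(1) q(1)]
      show "\<forall>\<^sub>F z in G. \<tau>' (x + y) z = \<tau>' x z + \<tau>' y z"
        by eventually_elim (simp add: p(2) q(2))
      from \<tau>'[OF p(1)] \<tau>'[OF q(1)] \<tau>'[OF closed(5)[OF p(1) q(1)]] apply_poly_mult[OF p(1) q(1)]
      show "\<forall>\<^sub>F z in G. \<tau>' (x * y) z = \<tau>' x z * \<tau>' y z"
        by eventually_elim (simp add: p(2) q(2))
    qed
  qed
qed

text \<open>All steps of the tower have odd degree, so each minimal polynomial acquires a real root
  to extend by.\<close>

lemma eventual_hom_extend_odd_degree:
  fixes E :: "'a::field_char_0 set"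
  assumes "subfield E type_ring" "eventual_hom G E \<tau>"
    and "ring.dimension type_ring n E UNIV" "odd n"
  shows "\<exists>\<tau>'. eventual_hom G UNIV \<tau>' \<and> (\<forall>e\<in>E. \<forall>\<^sub>F z in G. \<tau>' e z = \<tau> e z)"
  using assms
proof (induction n arbitrary: E \<tau> rule: less_induct)
  case (less n)
  interpret eventual_field_hom G E \<tau>
    by (rule eventual_field_hom.intro[OF less.prems(1,2)])
  show ?case
  proof (cases "E = UNIV")
    case True
    thus ?thesis
      using less.prems(2) by auto
  next
    case False
    obtain a m E' n'
      where m: "m \<in> polys_over E" "lead_coeff m = 1" "poly m a = 0"
        "\<And>p. p \<in> polys_over E \<Longrightarrow> p \<noteq> 0 \<Longrightarrow> poly p a = 0 \<Longrightarrow> degree m \<le> degree p"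
        "E' = {poly p a | p. p \<in> polys_over E}"
      and E': "subfield E' type_ring" "n = degree m * n'" "n' < n" "ring.dimension type_ring n' E' UNIV"
      by (rule proper_extension_step[OF less.prems(1,3) False]) (rule that, assumption+)
    \<comment> \<open>\<open>degree m\<close> divides the odd \<open>n\<close>. Where the degree is
      not preserved, the chosen \<open>t z\<close> is arbitrary, which is harmless since this
      happens only off an eventual set.\<close>
    have "\<exists>t. poly (apply_poly m z) t = 0" if "degree (apply_poly m z) = degree m" for z
      using that less.prems(4) E'(2) by (intro odd_degree_imp_real_root) simp
    hence "\<forall>z. \<exists>t. degree (apply_poly m z) = degree m \<longrightarrow> poly (apply_poly m z) t = 0"
      by blast
    from choice[OF this]
    obtain t where t: "\<And>z. degree (apply_poly m z) = degree m \<Longrightarrow> poly (apply_poly m z) (t z) = 0"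
      by blast
    have "\<forall>\<^sub>F z in G. poly (apply_poly m z) (t z) = 0"
      using degree_apply_poly[OF m(2)] by eventually_elim (rule t)
    from eventual_hom_extend[OF less.prems(1,2) m this]
    obtain \<tau>1 where \<tau>1: "eventual_hom G E' \<tau>1" "\<And>e. e \<in> E \<Longrightarrow> \<forall>\<^sub>F z in G. \<tau>1 e z = \<tau> e z"
      by blast
    from less.IH[OF E'(3,1) \<tau>1(1) E'(4)] obtain \<tau>2
      where \<tau>2: "eventual_hom G UNIV \<tau>2" "\<forall>e\<in>E'. \<forall>\<^sub>F z in G. \<tau>2 e z = \<tau>1 e z"
      using less.prems(4) E'(2) by auto
    have "\<forall>\<^sub>F z in G. \<tau>2 e z = \<tau> e z" if "e \<in> E" for e
    proof -
      have "poly [:e:] a \<in> E'"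
        unfolding m(5) using polys_over_closed(1,6)[OF less.prems(1)] that by blast
      hence "\<forall>\<^sub>F z in G. \<tau>2 e z = \<tau>1 e z"
        using \<tau>2(2) by simp
      with \<tau>1(2)[OF that] show ?thesis
        by eventually_elim simp
    qed
    thus ?thesis
      using \<tau>2(1) by blast
  qed
qed

text \<open>As long as the remaining degree \<open>n'\<close> is even, only the base field is
  enlarged. When it becomes odd, \<open>degree m\<close> is even, and the new homomorphism departs
  from \<open>\<sigma>\<close> at \<open>a\<close>.\<close>

lemma eventual_hom_even_degree_not_unique:
  fixes E :: "'a::field_char_0 set"
  assumes "subfield E type_ring" and \<sigma>: "eventual_hom G UNIV \<sigma>"
    and "ring.dimension type_ring n E UNIV" "even n"
  shows "\<exists>\<tau> a. eventual_hom G UNIV \<tau> \<and> (\<forall>e\<in>E. \<forall>\<^sub>F z in G. \<tau> e z = \<sigma> e z) \<and>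
           (\<forall>\<^sub>F z in G. \<tau> a z \<noteq> \<sigma> a z)"
  using assms(1,3,4)
proof (induction n arbitrary: E rule: less_induct)
  case (less n)
  interpret type_ring: domain "type_ring :: 'a ring" by (rule type_ring_is_domain)
  have UNIV: "subfield UNIV (type_ring :: 'a ring)"
    using field.carrier_is_subfield[OF type_ring_is_field] by simp
  have "eventual_hom G E \<sigma>"
    using \<sigma> by (rule eventual_hom_mono) simp
  interpret U: eventual_field_hom G UNIV \<sigma>
    by (rule eventual_field_hom.intro[OF UNIV \<sigma>])
  have "E \<noteq> UNIV"
  proof
    assume "E = UNIV"
    hence "n = 1"
      using type_ring.dimension_is_inj[OF UNIV _ type_ring.dimension_one[OF UNIV]] less.prems(2) by simp
    thus False
      using less.prems(3) by simp
  qed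
  obtain a m E' n'
    where m: "m \<in> polys_over E" "lead_coeff m = 1" "poly m a = 0"
      "\<And>p. p \<in> polys_over E \<Longrightarrow> p \<noteq> 0 \<Longrightarrow> poly p a = 0 \<Longrightarrow> degree m \<le> degree p"
      "E' = {poly p a | p. p \<in> polys_over E}"
    and E': "subfield E' type_ring" "1 < degree m" "n = degree m * n'" "n' < n" "ring.dimension type_ring n' E' UNIV"
    by (rule proper_extension_step[OF less.prems(1,2) \<open>E \<noteq> UNIV\<close>]) (rule that, assumption+)
  have incl: "e \<in> E'" if "e \<in> E" for e
  proof -
    have "poly [:e:] a \<in> E'"
      unfolding m(5) using polys_over_closed(1,6)[OF less.prems(1)] that by blast
    thus ?thesis by simp
  qed
  show ?case
  proof (cases "even n'")
    case True
    from less.IH[OF E'(4,1,5) this] show ?thesis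
      using incl by blast
  next
    case False
    hence even: "even (degree m)"
      using less.prems(3) E'(3) by simp
    \<comment> \<open>Separability in characteristic 0: the derivative is nonzero of smaller degree
      than \<open>m\<close>, so by minimality it does not vanish at \<open>a\<close>. Hence
      \<open>\<sigma> a z\<close> is eventually a simple root.\<close>
    have "pderiv m \<noteq> 0"
      using E'(2) by (simp add: pderiv_eq_0_iff)
    hence "poly (pderiv m) a \<noteq> 0"
      using m(4)[OF polys_over_closed(8)[OF less.prems(1) m(1)]] E'(2) by (auto simp: degree_pderiv)
    hence "\<forall>\<^sub>F z in G. \<sigma> (poly (pderiv m) a) z \<noteq> 0"
      by (intro U.nonzero) auto
    moreover have "\<forall>\<^sub>F z in G. \<sigma> (poly m a) z = poly (U.apply_poly m z) (\<sigma> a z)"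
      "\<forall>\<^sub>F z in G. \<sigma> (poly (pderiv m) a) z = poly (U.apply_poly (pderiv m) z) (\<sigma> a z)"
      "\<forall>\<^sub>F z in G. U.apply_poly (pderiv m) z = pderiv (U.apply_poly m z)"
      by (intro U.poly_apply_poly U.apply_poly_pderiv; simp)+
    ultimately have ev: "\<forall>\<^sub>F z in G. degree (U.apply_poly m z) = degree m \<and>
        poly (U.apply_poly m z) (\<sigma> a z) = 0 \<and> poly (pderiv (U.apply_poly m z)) (\<sigma> a z) \<noteq> 0"
      (is "\<forall>\<^sub>F z in G. ?P z")
      using U.zero U.degree_apply_poly[OF m(2)] by eventually_elim (simp add: m(3))
    have "\<forall>z. \<exists>t. ?P z \<longrightarrow> poly (U.apply_poly m z) t = 0 \<and> t \<noteq> \<sigma> a z"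
      using even even_degree_imp_other_root[of "U.apply_poly m z" "\<sigma> a z" for z] by auto
    from choice[OF this] obtain t where t: "\<And>z. ?P z \<Longrightarrow> poly (U.apply_poly m z) (t z) = 0 \<and> t z \<noteq> \<sigma> a z"
      by blast
    have root: "\<forall>\<^sub>F z in G. poly (U.apply_poly m z) (t z) = 0" and ne: "\<forall>\<^sub>F z in G. t z \<noteq> \<sigma> a z"
      using ev by (eventually_elim; use t in blast)+
    obtain \<tau>1 where \<tau>1: "eventual_hom G E' \<tau>1" "\<And>e. e \<in> E \<Longrightarrow> \<forall>\<^sub>F z in G. \<tau>1 e z = \<sigma> e z"
      "\<forall>\<^sub>F z in G. \<tau>1 a z = t z"
      using eventual_hom_extend[OF less.prems(1) \<open>eventual_hom G E \<sigma>\<close> m root] by blast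
    \<comment> \<open>The degree left above \<open>E'\<close> is odd, so the homomorphism sending
      \<open>a\<close> to the other root extends to the whole field.\<close>
    obtain \<tau>2 where \<tau>2: "eventual_hom G UNIV \<tau>2" "\<forall>e\<in>E'. \<forall>\<^sub>F z in G. \<tau>2 e z = \<tau>1 e z"
      using eventual_hom_extend_odd_degree[OF E'(1) \<tau>1(1) E'(5) False] by blast
    have "poly [:0, 1:] a \<in> E'"
      unfolding m(5) using polys_over_closed(1,6)[OF less.prems(1)] subfield_type_ring_closed(1,2)[OF less.prems(1)]
      by blast
    hence "\<forall>\<^sub>F z in G. \<tau>2 a z = \<tau>1 a z"
      using \<tau>2(2) by simp
    with \<tau>1(3) ne have "\<forall>\<^sub>F z in G. \<tau>2 a z \<noteq> \<sigma> a z"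
      by eventually_elim simp
    moreover have "\<forall>\<^sub>F z in G. \<tau>2 e z = \<sigma> e z" if "e \<in> E" for e
      using \<tau>2(2)[rule_format, OF incl[OF that]] \<tau>1(2)[OF that] by eventually_elim simp
    ultimately show ?thesis
      using \<tau>2(1) by blast
  qed
qed

section \<open>Evaluation of rational functions at generic points\<close>

text \<open>Characteristic 0 is what the separability argument demands of the function
  field.\<close>

instance fract :: ("{idom, ring_char_0}") field_char_0
  by standard (simp add: inj_on_def of_nat_fract eq_fract)

text \<open>Induction on the variables. Monomials are indexed by an arbitrary type with an
  injectivity condition, so that the lemma serves both for exponents given as
  \<open>poly_mapping\<close> and for exponents given as functions.\<close>

lemma monomial_functions_independent:
  fixes c :: "'m \<Rightarrow> real" and e :: "'m \<Rightarrow> 'n \<Rightarrow> nat"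
  assumes "finite S" "finite M"
    and "\<And>x. (\<Sum>m\<in>M. c m * (\<Prod>i\<in>S. x i ^ e m i)) = 0"
    and "\<And>m m'. m \<in> M \<Longrightarrow> m' \<in> M \<Longrightarrow> (\<And>i. i \<in> S \<Longrightarrow> e m i = e m' i) \<Longrightarrow> m = m'"
    and "m \<in> M"
  shows "c m = 0"
  using assms
proof (induction S arbitrary: M m)
  case (empty M)
  hence "M = {m}"
    by blast
  thus ?case
    using empty.prems(2) by simp
next
  case (insert i S M)
  define Mm where "Mm = {m'\<in>M. e m' i = e m i}"
  have "(\<Sum>m'\<in>Mm. c m' * (\<Prod>j\<in>S. x j ^ e m' j)) = 0" for x :: "'n \<Rightarrow> real"
  proof -
    \<comment> \<open>The sum as a polynomial in the variable \<open>i\<close>, the others being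
      fixed. It vanishes at all reals, so its coefficient at \<open>e m i\<close> is zero, and this
      is the sum over \<open>Mm\<close>.\<close>
    define p where "p = (\<Sum>m'\<in>M. monom (c m' * (\<Prod>j\<in>S. x j ^ e m' j)) (e m' i))"
    have "poly p t = 0" for t
    proof -
      have "poly p t = (\<Sum>m'\<in>M. c m' * (\<Prod>j\<in>insert i S. (x(i := t)) j ^ e m' j))"
        unfolding p_def poly_sum
      proof (rule sum.cong[OF refl])
        fix m'
        have "(\<Prod>j\<in>S. (x(i := t)) j ^ e m' j) = (\<Prod>j\<in>S. x j ^ e m' j)"
          using insert.hyps(2) by (intro prod.cong) auto
        thus "poly (monom (c m' * (\<Prod>j\<in>S. x j ^ e m' j)) (e m' i)) t =
            c m' * (\<Prod>j\<in>insert i S. (x(i := t)) j ^ e m' j)"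
          using insert.hyps by (simp add: poly_monom)
      qed
      thus ?thesis
        using insert.prems(2) by simp
    qed
    hence "p = 0"
      by (simp add: poly_all_0_iff_0[symmetric])
    hence "coeff p (e m i) = 0"
      by simp
    thus ?thesis
      using insert.prems(1) by (simp add: p_def Mm_def coeff_sum sum.If_cases Int_def conj_commute)
  qed
  thus ?case
  proof (intro insert.IH[of Mm m])
    fix m1 m2 assume "m1 \<in> Mm" "m2 \<in> Mm" "\<And>j. j \<in> S \<Longrightarrow> e m1 j = e m2 j"
    thus "m1 = m2"
      by (intro insert.prems(3)) (auto simp: Mm_def)
  qed (use insert.prems in \<open>auto simp: Mm_def\<close>)
qed

section \<open>Evaluation of polynomials in several variables\<close>

lemma poly_mapping_sum_single: "(\<Sum>m\<in>Poly_Mapping.keys p. Poly_Mapping.single m (Poly_Mapping.lookup p m)) = p"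
  by (rule poly_mapping_eqI) (auto simp: lookup_sum lookup_single when_def in_keys_iff)

lemma lookup_single_zero_mult: "Poly_Mapping.lookup (Poly_Mapping.single 0 c * p) m = c * Poly_Mapping.lookup p m"
  for c :: "'a::comm_semiring_1"
  by (simp flip: mult_map_scale_conv_mult add: map.rep_eq when_def)

context
  fixes x :: "real ^ 'n::finite"
begin

text \<open>Terms outside the support contribute 0, so polynomials with different supports can be
  summed over a common index set.\<close>

lemma mpoly_eval_superset:
  assumes "finite S" "Poly_Mapping.keys p \<subseteq> S"
  shows "mpoly_eval p x = (\<Sum>m\<in>S. Poly_Mapping.lookup p m * (\<Prod>i\<in>UNIV. (x $ i) ^ Poly_Mapping.lookup m i))"
  unfolding mpoly_eval_def using assms by (intro sum.mono_neutral_left) (auto simp: in_keys_iff)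

lemma mpoly_eval_zero [simp]: "mpoly_eval 0 x = 0"
  by (simp add: mpoly_eval_def)

lemma mpoly_eval_single [simp]:
  "mpoly_eval (Poly_Mapping.single m c) x = c * (\<Prod>i\<in>UNIV. (x $ i) ^ Poly_Mapping.lookup m i)"
  by (subst mpoly_eval_superset[of "{m}"]) auto

lemma mpoly_eval_one [simp]: "mpoly_eval 1 x = 1"
  by (simp flip: single_one)

lemma mpoly_eval_add [simp]: "mpoly_eval (p + q) x = mpoly_eval p x + mpoly_eval q x"
  using keys_add[of p q]
  by (simp add: mpoly_eval_superset[of "Poly_Mapping.keys p \<union> Poly_Mapping.keys q"] lookup_add algebra_simps sum.distrib)

lemma mpoly_eval_sum [simp]: "mpoly_eval (\<Sum>s\<in>S. g s) x = (\<Sum>s\<in>S. mpoly_eval (g s) x)"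
  by (induction S rule: infinite_finite_induct) auto

lemma mpoly_eval_mult [simp]: "mpoly_eval (p * q) x = mpoly_eval p x * mpoly_eval q x"
proof -
  have "mpoly_eval (Poly_Mapping.single m c * Poly_Mapping.single n d) x =
      mpoly_eval (Poly_Mapping.single m c) x * mpoly_eval (Poly_Mapping.single n d) x"
    for m n and c d :: real
    by (simp add: mult_single lookup_add power_add prod.distrib)
  hence "mpoly_eval ((\<Sum>m\<in>Poly_Mapping.keys p. Poly_Mapping.single m (Poly_Mapping.lookup p m)) *
        (\<Sum>m\<in>Poly_Mapping.keys q. Poly_Mapping.single m (Poly_Mapping.lookup q m))) x =
      mpoly_eval (\<Sum>m\<in>Poly_Mapping.keys p. Poly_Mapping.single m (Poly_Mapping.lookup p m)) x *
      mpoly_eval (\<Sum>m\<in>Poly_Mapping.keys q. Poly_Mapping.single m (Poly_Mapping.lookup q m)) x"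
    by (simp add: sum_product del: mpoly_eval_single)
  thus ?thesis
    by (simp only: poly_mapping_sum_single)
qed

lemma mpoly_eval_prod [simp]: "mpoly_eval (\<Prod>s\<in>S. g s) x = (\<Prod>s\<in>S. mpoly_eval (g s) x)"
  by (induction S rule: infinite_finite_induct) auto

lemma mpoly_eval_power [simp]: "mpoly_eval (p ^ k) x = mpoly_eval p x ^ k"
  by (induction k) auto

end

lemma mpoly_eval_nonzero:
  assumes "p \<noteq> 0"
  shows "\<exists>x. mpoly_eval p x \<noteq> 0"
proof (rule ccontr)
  assume "\<not> ?thesis"
  hence "mpoly_eval p (\<chi> i. y i) = 0" for y
    by blast
  hence "Poly_Mapping.lookup p m = 0" if "m \<in> Poly_Mapping.keys p" for m
    using that
    by (intro monomial_functions_independent[of UNIV "Poly_Mapping.keys p" "Poly_Mapping.lookup p" Poly_Mapping.lookup])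
      (auto simp: mpoly_eval_def intro: poly_mapping_eqI)
  hence "p = 0"
    by (intro poly_mapping_eqI) (auto simp: in_keys_iff)
  thus False
    using assms by simp
qed

definition mpoly_var :: "'n::finite \<Rightarrow> 'n real_mpoly" where
  "mpoly_var i = Poly_Mapping.single (Poly_Mapping.single i 1) 1"

text \<open>Reduces statements about homomorphisms and subfields to constants and variables.\<close>

lemma mpoly_eq_sum_monomials:
  fixes p :: "'n::finite real_mpoly"
  shows "p = (\<Sum>m\<in>Poly_Mapping.keys p. Poly_Mapping.single 0 (Poly_Mapping.lookup p m) *
    (\<Prod>i\<in>UNIV. mpoly_var i ^ Poly_Mapping.lookup m i))"
proof -
  have pow: "mpoly_var i ^ k = Poly_Mapping.single (Poly_Mapping.single i k) 1" for i :: 'n and k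
    by (induction k) (simp_all add: mpoly_var_def mult_single single_add[symmetric])
  have prod: "(\<Prod>i\<in>S. Poly_Mapping.single (g i) 1) = Poly_Mapping.single (\<Sum>i\<in>S. g i) (1 :: real)"
    for S and g :: "'n \<Rightarrow> 'n \<Rightarrow>\<^sub>0 nat"
    by (induction S rule: infinite_finite_induct) (simp_all add: mult_single)
  have "(\<Sum>i\<in>UNIV. Poly_Mapping.single i (Poly_Mapping.lookup m i)) = m" for m :: "'n \<Rightarrow>\<^sub>0 nat"
    by (rule poly_mapping_eqI) (simp add: lookup_sum lookup_single when_def)
  thus ?thesis
    by (simp add: pow prod mult_single poly_mapping_sum_single)
qed

text \<open>The filter generated by the complements of proper real hypersurfaces. It is closed under
  intersection because a product of nonzero polynomials is nonzero.\<close>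

definition zariski_generic :: "(real ^ 'n::{finite,linorder}) filter" where
  "zariski_generic = Abs_filter (\<lambda>P. \<exists>q. q \<noteq> 0 \<and> (\<forall>x. mpoly_eval q x \<noteq> 0 \<longrightarrow> P x))"

lemma eventually_zariski_generic:
  fixes P :: "real ^ 'n::{finite,linorder} \<Rightarrow> bool"
  shows "eventually P zariski_generic \<longleftrightarrow> (\<exists>q. q \<noteq> 0 \<and> (\<forall>x. mpoly_eval q x \<noteq> 0 \<longrightarrow> P x))"
  unfolding zariski_generic_def
proof (rule eventually_Abs_filter, standard)
  fix P Q :: "real ^ 'n::{finite,linorder} \<Rightarrow> bool"
  assume "\<exists>q. q \<noteq> 0 \<and> (\<forall>x. mpoly_eval q x \<noteq> 0 \<longrightarrow> P x)"
    "\<exists>q. q \<noteq> 0 \<and> (\<forall>x. mpoly_eval q x \<noteq> 0 \<longrightarrow> Q x)"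
  then obtain p q where "p \<noteq> 0" "\<forall>x. mpoly_eval p x \<noteq> 0 \<longrightarrow> P x" "q \<noteq> 0" "\<forall>x. mpoly_eval q x \<noteq> 0 \<longrightarrow> Q x"
    by blast
  thus "\<exists>q. q \<noteq> 0 \<and> (\<forall>x. mpoly_eval q x \<noteq> 0 \<longrightarrow> P x \<and> Q x)"
    by (intro exI[of _ "p * q"]) auto
qed (auto intro: exI[of _ 1])

lemma zariski_generic_neq_bot: "zariski_generic \<noteq> bot"
  unfolding trivial_limit_def eventually_zariski_generic using mpoly_eval_nonzero by blast

lemma eventually_mpoly_eval_nonzero: "q \<noteq> 0 \<Longrightarrow> \<forall>\<^sub>F x in zariski_generic. mpoly_eval q x \<noteq> 0"
  unfolding eventually_zariski_generic by blast

text \<open>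
  The value at \<open>x\<close> depends on the chosen fraction if its denominator vanishes at \<open>x\<close>; generically it does not.
\<close>

definition ratfun_eval :: "'n::{finite,linorder} real_ratfun \<Rightarrow> real ^ 'n::{finite,linorder} \<Rightarrow> real" where
  "ratfun_eval r x = (let (p, q) = (SOME (p, q). r = Fract p q \<and> q \<noteq> 0) in mpoly_eval p x / mpoly_eval q x)"

text \<open>Cross multiplication of two fractions for the same element is a polynomial identity, so
  their values agree wherever neither denominator vanishes.\<close>

lemma eventually_ratfun_eval_Fract:
  fixes p q :: "'n::{finite,linorder} real_mpoly"
  assumes "q \<noteq> 0"
  shows "\<forall>\<^sub>F x in zariski_generic. ratfun_eval (Fract p q) x = mpoly_eval p x / mpoly_eval q x"
proof -
  obtain p' q' where pq': "(SOME (p', q'). Fract p q = Fract p' q' \<and> q' \<noteq> 0) = (p', q')"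
    by (cases "SOME (p', q'). Fract p q = Fract p' q' \<and> q' \<noteq> 0")
  have "case (p', q') of (p', q') \<Rightarrow> Fract p q = Fract p' q' \<and> q' \<noteq> 0"
    unfolding pq'[symmetric] by (rule someI[of _ "(p, q)"]) (use assms in simp)
  hence eq: "Fract p q = Fract p' q'" and q': "q' \<noteq> 0"
    by simp_all
  from eq have "p * q' = p' * q"
    unfolding eq_fract(1)[OF assms q'] .
  hence "mpoly_eval (p * q') x = mpoly_eval (p' * q) x" for x
    by simp
  hence *: "mpoly_eval p x * mpoly_eval q' x = mpoly_eval p' x * mpoly_eval q x" for x
    by simp
  show ?thesis
    using eventually_mpoly_eval_nonzero[OF assms] eventually_mpoly_eval_nonzero[OF q']
    by eventually_elim (use * pq' in \<open>simp add: ratfun_eval_def frac_eq_eq\<close>)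
qed

lemma eventual_hom_ratfun_eval:
  "eventual_hom zariski_generic (UNIV :: 'n::{finite,linorder} real_ratfun set) ratfun_eval"
  unfolding eventual_hom_def
proof (intro conjI ballI)
  show "\<forall>\<^sub>F x in zariski_generic. ratfun_eval 1 x = 1"
    using eventually_ratfun_eval_Fract[of 1 1] by (simp add: One_fract_def)
next
  fix r s :: "'n real_ratfun"
  obtain a b where r: "r = Fract a b" "b \<noteq> 0" by (cases r)
  obtain c d where s: "s = Fract c d" "d \<noteq> 0" by (cases s)
  have bd: "b * d \<noteq> 0"
    using r s by simp
  note ev = eventually_mpoly_eval_nonzero[OF r(2)] eventually_mpoly_eval_nonzero[OF s(2)]
    eventually_ratfun_eval_Fract[OF r(2), of a] eventually_ratfun_eval_Fract[OF s(2), of c]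
  show "\<forall>\<^sub>F x in zariski_generic. ratfun_eval (r + s) x = ratfun_eval r x + ratfun_eval s x"
    using ev eventually_ratfun_eval_Fract[OF bd, of "a * d + c * b"]
    by eventually_elim (use r(2) s(2) in \<open>simp add: r(1) s(1) add_frac_eq\<close>)
  show "\<forall>\<^sub>F x in zariski_generic. ratfun_eval (r * s) x = ratfun_eval r x * ratfun_eval s x"
    using ev eventually_ratfun_eval_Fract[OF bd, of "a * c"]
    by eventually_elim (simp add: r(1) s(1))
qed

lemma ratfun_const_conv_to_fract: "ratfun_const c = to_fract (Poly_Mapping.single 0 c)"
  by (simp add: ratfun_const_def to_fract_def)

lemma to_fract_prod: "to_fract (\<Prod>s\<in>S. g s) = (\<Prod>s\<in>S. to_fract (g s))"
  by (induction S rule: infinite_finite_induct) auto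

lemma to_fract_power: "to_fract (p ^ k) = to_fract p ^ k"
  by (induction k) auto

text \<open>A homomorphism that fixes the real constants acts on polynomials as evaluation at the
  point formed by the images of the variables. Only finitely many generic conditions enter for each
  \<open>p\<close>.\<close>

lemma eventual_hom_mpoly:
  fixes \<tau> :: "'n::{finite,linorder} real_ratfun \<Rightarrow> 'z \<Rightarrow> real"
  assumes hom: "eventual_hom G UNIV \<tau>" and const: "\<And>c. \<forall>\<^sub>F z in G. \<tau> (ratfun_const c) z = c"
  shows "\<forall>\<^sub>F z in G. \<tau> (to_fract p) z = mpoly_eval p (\<chi> i. \<tau> (to_fract (mpoly_var i)) z)"
proof -
  have "subfield UNIV (type_ring :: 'n real_ratfun ring)"
    using field.carrier_is_subfield[OF type_ring_is_field] by simp
  then interpret eventual_field_hom G UNIV \<tau>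
    using hom by (rule eventual_field_hom.intro)
  let ?X = "\<lambda>i::'n. to_fract (mpoly_var i)"
  have "to_fract p = (\<Sum>m\<in>Poly_Mapping.keys p. ratfun_const (Poly_Mapping.lookup p m) *
      (\<Prod>i\<in>UNIV. ?X i ^ Poly_Mapping.lookup m i))"
    (is "_ = ?sum")
  proof -
    have "to_fract (\<Sum>m\<in>Poly_Mapping.keys p. Poly_Mapping.single 0 (Poly_Mapping.lookup p m) *
        (\<Prod>i\<in>UNIV. mpoly_var i ^ Poly_Mapping.lookup m i)) = ?sum"
      by (simp add: to_fract_prod to_fract_power ratfun_const_conv_to_fract)
    thus ?thesis
      by (simp only: mpoly_eq_sum_monomials[symmetric])
  qed
  hence "\<forall>\<^sub>F z in G. \<tau> (to_fract p) z =
      (\<Sum>m\<in>Poly_Mapping.keys p. \<tau> (ratfun_const (Poly_Mapping.lookup p m) *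
        (\<Prod>i\<in>UNIV. ?X i ^ Poly_Mapping.lookup m i)) z)"
    using sum[of "Poly_Mapping.keys p" "\<lambda>m. ratfun_const (Poly_Mapping.lookup p m) *
      (\<Prod>i\<in>UNIV. ?X i ^ Poly_Mapping.lookup m i)"] by simp
  moreover have "\<forall>\<^sub>F z in G. \<forall>m\<in>Poly_Mapping.keys p.
      \<tau> (ratfun_const (Poly_Mapping.lookup p m) * (\<Prod>i\<in>UNIV. ?X i ^ Poly_Mapping.lookup m i)) z =
      \<tau> (ratfun_const (Poly_Mapping.lookup p m)) z * \<tau> (\<Prod>i\<in>UNIV. ?X i ^ Poly_Mapping.lookup m i) z"
    by (intro eventually_ball_finite ballI mult) auto
  moreover have "\<forall>\<^sub>F z in G. \<forall>m\<in>Poly_Mapping.keys p. \<tau> (ratfun_const (Poly_Mapping.lookup p m)) z = Poly_Mapping.lookup p m"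
    by (intro eventually_ball_finite ballI const) auto
  moreover have "\<forall>\<^sub>F z in G. \<forall>m\<in>Poly_Mapping.keys p.
      \<tau> (\<Prod>i\<in>UNIV. ?X i ^ Poly_Mapping.lookup m i) z = (\<Prod>i\<in>UNIV. \<tau> (?X i ^ Poly_Mapping.lookup m i) z)"
    by (intro eventually_ball_finite ballI prod) auto
  moreover have "\<forall>\<^sub>F z in G. \<forall>m\<in>Poly_Mapping.keys p. \<forall>i\<in>UNIV.
      \<tau> (?X i ^ Poly_Mapping.lookup m i) z = \<tau> (?X i) z ^ Poly_Mapping.lookup m i"
    by (intro eventually_ball_finite ballI power) auto
  ultimately show ?thesis
    by eventually_elim (simp add: mpoly_eval_def)
qed

section \<open>Finiteness of the extension\<close>

text \<open>Gaussian elimination, one equation at a time.\<close>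

lemma underdetermined_linear_system:
  fixes a :: "'i \<Rightarrow> 'j \<Rightarrow> 'a::field"
  assumes "finite I" "finite J" "card I < card J"
  shows "\<exists>c. (\<exists>j\<in>J. c j \<noteq> 0) \<and> (\<forall>i\<in>I. (\<Sum>j\<in>J. c j * a i j) = 0)"
  using assms
proof (induction I arbitrary: a J)
  case empty
  hence "J \<noteq> {}"
    by auto
  thus ?case
    by (intro exI[of _ "\<lambda>_. 1"]) auto
next
  case (insert i I)
  show ?case
  proof (cases "\<forall>j\<in>J. a i j = 0")
    case True
    have "card I < card J"
      using insert.hyps insert.prems(2) by simp
    from insert.IH[OF insert.prems(1) this] True show ?thesis
      by fastforce
  next
    case False
    then obtain k where k: "k \<in> J" "a i k \<noteq> 0"
      by blast
    define J' where "J' = J - {k}"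
    have J: "J = insert k J'" "k \<notin> J'" "finite J'"
      using k insert.prems(1) by (auto simp: J'_def)
    have "card I < card J'"
      using insert.hyps insert.prems(2) J by simp
    \<comment> \<open>The coefficients of the other equations once equation \<open>i\<close> has
      been used to eliminate the unknown \<open>k\<close>.\<close>
    from insert.IH[OF J(3) this, of "\<lambda>i' j. a i' j - a i j * a i' k / a i k"]
    obtain c where c: "\<exists>j\<in>J'. c j \<noteq> 0"
      "\<And>i'. i' \<in> I \<Longrightarrow> (\<Sum>j\<in>J'. c j * (a i' j - a i j * a i' k / a i k)) = 0"
      by blast
    define c' where "c' = c(k := - (\<Sum>j\<in>J'. c j * a i j) / a i k)"
    have sum: "(\<Sum>j\<in>J. c' j * a i' j) = (\<Sum>j\<in>J'. c j * a i' j) - (\<Sum>j\<in>J'. c j * a i j) / a i k * a i' k" for i'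
    proof -
      have "(\<Sum>j\<in>J'. c' j * a i' j) = (\<Sum>j\<in>J'. c j * a i' j)"
        using J(2) by (intro sum.cong) (auto simp: c'_def)
      thus ?thesis
        using J by (simp add: c'_def)
    qed
    have "(\<Sum>j\<in>J. c' j * a i' j) = 0" if "i' \<in> insert i I" for i'
    proof (cases "i' = i")
      case True
      thus ?thesis
        using k(2) by (simp add: sum)
    next
      case False
      hence "(\<Sum>j\<in>J'. c j * (a i' j - a i j * a i' k / a i k)) = 0"
        using that c(2) by blast
      thus ?thesis
        by (simp add: sum algebra_simps sum_subtractf sum_distrib_left sum_divide_distrib)
    qed
    moreover have "\<exists>j\<in>J. c' j \<noteq> 0"
      using c(1) J(1,2) by (auto simp: c'_def)
    ultimately show ?thesis
      by blast
  qed
qed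

text \<open>Bounding each exponent separately makes the admissible monomials a box, whose size is
  simply a power.\<close>

definition partial_degrees_le :: "nat \<Rightarrow> 'n real_mpoly \<Rightarrow> bool" where
  "partial_degrees_le d p \<longleftrightarrow> (\<forall>m\<in>Poly_Mapping.keys p. \<forall>i. Poly_Mapping.lookup m i \<le> d)"

lemma partial_degrees_le_mono: "partial_degrees_le d p \<Longrightarrow> d \<le> e \<Longrightarrow> partial_degrees_le e p"
  by (auto simp: partial_degrees_le_def intro: order_trans)

lemma partial_degrees_le_exists: "\<exists>d. partial_degrees_le d (p :: 'n::finite real_mpoly)"
proof -
  define d where "d = (\<Sum>m\<in>Poly_Mapping.keys p. \<Sum>i\<in>UNIV. Poly_Mapping.lookup m i)"
  have "Poly_Mapping.lookup m i \<le> d" if "m \<in> Poly_Mapping.keys p" for m i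
  proof -
    have "Poly_Mapping.lookup m i \<le> (\<Sum>i\<in>UNIV. Poly_Mapping.lookup m i)"
      by (rule member_le_sum) auto
    also have "\<dots> \<le> d"
      unfolding d_def using that by (intro member_le_sum) auto
    finally show ?thesis .
  qed
  thus ?thesis
    unfolding partial_degrees_le_def by blast
qed

lemma partial_degrees_le_one: "partial_degrees_le d 1"
  by (simp add: partial_degrees_le_def)

lemma partial_degrees_le_mult:
  assumes "partial_degrees_le d p" "partial_degrees_le e q"
  shows "partial_degrees_le (d + e) (p * q)"
  unfolding partial_degrees_le_def
proof (intro ballI allI)
  fix m i assume "m \<in> Poly_Mapping.keys (p * q)"
  then obtain a b where "a \<in> Poly_Mapping.keys p" "b \<in> Poly_Mapping.keys q" "m = a + b"
    using keys_mult[of p q] by blast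
  thus "Poly_Mapping.lookup m i \<le> d + e"
    using assms by (auto simp: partial_degrees_le_def lookup_add intro: add_mono)
qed

lemma partial_degrees_le_prod:
  assumes "\<And>s. s \<in> S \<Longrightarrow> partial_degrees_le (d s) (g s)"
  shows "partial_degrees_le (\<Sum>s\<in>S. d s) (\<Prod>s\<in>S. g s)"
  using assms
  by (induction S rule: infinite_finite_induct) (auto intro: partial_degrees_le_one partial_degrees_le_mult)

lemma partial_degrees_le_power: "partial_degrees_le d p \<Longrightarrow> partial_degrees_le (k * d) (p ^ k)"
  using partial_degrees_le_prod[of "{..<k}" "\<lambda>_. d" "\<lambda>_. p"] by simp

lemma card_bounded_monomials:
  fixes N :: nat
  defines "A \<equiv> {m :: 'n::finite \<Rightarrow>\<^sub>0 nat. \<forall>i. Poly_Mapping.lookup m i \<le> N}"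
  shows "finite A" "card A \<le> (N + 1) ^ CARD('n)"
proof -
  have inj: "inj_on Poly_Mapping.lookup A"
    by (simp add: inj_on_def lookup_inject)
  have sub: "Poly_Mapping.lookup ` A \<subseteq> Pi\<^sub>E UNIV (\<lambda>_. {..N})"
    by (auto simp: A_def)
  have fin: "finite (Pi\<^sub>E (UNIV :: 'n set) (\<lambda>_. {..N}))"
    by (intro finite_PiE) auto
  show "finite A"
    using finite_imageD[OF finite_subset[OF sub fin] inj] .
  show "card A \<le> (N + 1) ^ CARD('n)"
    using card_inj_on_le[OF inj sub fin] by (simp add: card_PiE)
qed

section \<open>The function field over the subfield generated by the components\<close>

lemma subfield_generated_ratfun_subfield: "subfield (generated_ratfun_subfield f) type_ring"
  and ratfun_const_in_generated: "ratfun_const c \<in> generated_ratfun_subfield f"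
  and generator_in_generated: "f i \<in> generated_ratfun_subfield f"
proof -
  have "field ratfun_field"
    unfolding ratfun_field_def by (rule type_ring_is_field)
  then show "subfield (generated_ratfun_subfield f) type_ring"
    unfolding generated_ratfun_subfield_def
    by (metis field.generate_field_is_subfield ratfun_field_def subset_UNIV type_ring_simps(1))
  show "ratfun_const c \<in> generated_ratfun_subfield f" "f i \<in> generated_ratfun_subfield f"
    by (auto simp: generated_ratfun_subfield_def intro: generate_field.incl)
qed

text \<open>The product of the denominators again vanishes nowhere, so clearing denominators is
  legitimate at every point and not just generically.\<close>

lemma common_denominator:
  fixes F :: "real ^ 'n::{finite,linorder} \<Rightarrow> real ^ 'n::{finite,linorder}"
  assumes "\<forall>i. everywhere_defined_as (f i) (\<lambda>x. F x $ i)"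
  obtains p q where "q \<noteq> 0" "\<And>i. f i * to_fract q = to_fract (p i)" "\<And>x. mpoly_eval q x \<noteq> 0"
    "\<And>i x. F x $ i * mpoly_eval q x = mpoly_eval (p i) x"
proof -
  from assms have "\<forall>i. \<exists>pq. f i = Fract (fst pq) (snd pq) \<and>
      (\<forall>x. mpoly_eval (snd pq) x \<noteq> 0 \<and> F x $ i = mpoly_eval (fst pq) x / mpoly_eval (snd pq) x)"
    by (auto simp: everywhere_defined_as_def)
  from choice[OF this] obtain pq where pq: "\<And>i. f i = Fract (fst (pq i)) (snd (pq i))"
    "\<And>i x. mpoly_eval (snd (pq i)) x \<noteq> 0"
    "\<And>i x. F x $ i = mpoly_eval (fst (pq i)) x / mpoly_eval (snd (pq i)) x"
    by blast
  define q where "q = (\<Prod>i\<in>UNIV. snd (pq i))"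
  define r where "r i = (\<Prod>j\<in>UNIV - {i}. snd (pq j))" for i
  have q: "q = snd (pq i) * r i" for i
    unfolding q_def r_def by (rule prod.remove) auto
  have nz: "mpoly_eval q x \<noteq> 0" for x
    using pq(2) by (simp add: q_def)
  have nz': "snd (pq i) \<noteq> 0" for i
    using pq(2)[of i] by force
  show ?thesis
  proof (rule that[of q "\<lambda>i. fst (pq i) * r i"])
    show "q \<noteq> 0"
      using nz by force
    show "f i * to_fract q = to_fract (fst (pq i) * r i)" for i
      using nz'[of i] by (simp add: pq(1) q[of i] Fract_conv_to_fract)
    show "F x $ i * mpoly_eval q x = mpoly_eval (fst (pq i) * r i) x" for i x
      using pq(2)[of i x] by (simp add: pq(3) q[of i])
  qed (rule nz)
qed

lemma variable_algebraic_over_generated: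
  fixes F :: "real ^ 'n::{finite,linorder} \<Rightarrow> real ^ 'n::{finite,linorder}"
  assumes f: "\<forall>i. everywhere_defined_as (f i) (\<lambda>x. F x $ i)" and surj: "surj F"
  shows "\<exists>P\<in>polys_over (generated_ratfun_subfield f). P \<noteq> 0 \<and> poly P (to_fract (mpoly_var i)) = 0"
proof -
  obtain p q where pq: "q \<noteq> 0" "\<And>i. f i * to_fract q = to_fract (p i)" "\<And>x. mpoly_eval q x \<noteq> 0"
    "\<And>i x. F x $ i * mpoly_eval q x = mpoly_eval (p i) x"
    by (rule common_denominator[OF f]) blast
  have "\<forall>i. \<exists>d. partial_degrees_le d (p i)"
    using partial_degrees_le_exists by blast
  from choice[OF this] obtain dp where dp: "\<And>i. partial_degrees_le (dp i) (p i)"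
    by blast
  obtain dq where dq: "partial_degrees_le dq q"
    using partial_degrees_le_exists by blast
  define D where "D = dq + (\<Sum>i\<in>UNIV. dp i)"
  have Dp: "partial_degrees_le D (p i)" for i
  proof -
    have "dp i \<le> (\<Sum>i\<in>UNIV. dp i)"
      by (rule member_le_sum) auto
    thus ?thesis
      using partial_degrees_le_mono[OF dp] by (simp add: D_def)
  qed
  have Dq: "partial_degrees_le D q"
    using partial_degrees_le_mono[OF dq] by (simp add: D_def)
  \<comment> \<open>The products \<open>x\<^sub>i\<^sup>k f\<^sup>l\<close> with all exponents at most \<open>N\<close>, cleared of denominators by \<open>q\<^sup>N\<^sup>n\<close>, are
    \<open>(N + 1)\<^sup>n\<^sup>+\<^sup>1\<close> polynomials of degree at most \<open>N M\<close> in each variable. Such polynomials span at most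
    \<open>(N M + 1)\<^sup>n \<le> M\<^sup>n (N + 1)\<^sup>n\<close> dimensions, so \<open>N = M\<^sup>n\<close> forces a linear relation.\<close>
  define n where "n = CARD('n)"
  define M where "M = 1 + n * D"
  define N where "N = M ^ n"
  define B where "B = Pi\<^sub>E (UNIV :: 'n set) (\<lambda>_. {..N})"
  define J where "J = {..N} \<times> B"
  define I where "I = {m :: 'n \<Rightarrow>\<^sub>0 nat. \<forall>i. Poly_Mapping.lookup m i \<le> N * M}"
  \<comment> \<open>The numerator of the product of the \<open>f j ^ l j\<close> over
    \<open>q ^ (N * n)\<close>, a denominator that is the same for all \<open>l\<close> in
    \<open>B\<close>.\<close>
  define g where "g l = (\<Prod>j\<in>UNIV. p j ^ l j * q ^ (N - l j))" for l
  define h where "h kl = mpoly_var i ^ fst kl * g (snd kl)" for kl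
  let ?X = "to_fract (mpoly_var i)"
  have finB: "finite B"
    unfolding B_def by (intro finite_PiE) auto
  have finJ: "finite J"
    unfolding J_def using finB by simp
  have B_le: "l j \<le> N" if "l \<in> B" for l j
    using that by (auto simp: B_def PiE_iff)
  have "card I \<le> (N * M + 1) ^ n"
    unfolding I_def n_def by (rule card_bounded_monomials(2))
  also have "\<dots> \<le> (M * (N + 1)) ^ n"
    by (intro power_mono) (auto simp: M_def algebra_simps)
  also have "\<dots> = N * (N + 1) ^ n"
    by (simp only: power_mult_distrib N_def)
  also have "\<dots> < (N + 1) * (N + 1) ^ n"
    by simp
  also have "\<dots> = card J"
    by (simp add: J_def B_def card_cartesian_product card_PiE n_def)
  finally have "card I < card J" .
  moreover have "finite I"
    unfolding I_def by (rule card_bounded_monomials(1))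
  ultimately obtain c where c: "\<exists>kl\<in>J. c kl \<noteq> 0"
    "\<And>m. m \<in> I \<Longrightarrow> (\<Sum>kl\<in>J. c kl * Poly_Mapping.lookup (h kl) m) = 0"
    using underdetermined_linear_system[of I J "\<lambda>m kl. Poly_Mapping.lookup (h kl) m"] finJ by blast
  have keys_h: "Poly_Mapping.keys (h kl) \<subseteq> I" if "kl \<in> J" for kl
  proof -
    have "partial_degrees_le 1 (mpoly_var i)"
      by (simp add: partial_degrees_le_def mpoly_var_def lookup_single when_def)
    hence 1: "partial_degrees_le (fst kl * 1) (mpoly_var i ^ fst kl)"
      by (rule partial_degrees_le_power)
    have 2: "partial_degrees_le (\<Sum>j\<in>(UNIV :: 'n set). snd kl j * D + (N - snd kl j) * D) (g (snd kl))"
      unfolding g_def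
      by (intro partial_degrees_le_prod partial_degrees_le_mult partial_degrees_le_power Dp Dq)
    \<comment> \<open>The exponents of \<open>p j\<close> and \<open>q\<close> add up to
      \<open>N\<close>, so \<open>g\<close> contributes at most \<open>n * (N * D)\<close> to each
      partial degree and the power of the variable at most \<open>N\<close>: together
      \<open>N * M\<close>.\<close>
    have "snd kl j * D + (N - snd kl j) * D = N * D" for j
      using B_le[of "snd kl" j] that by (auto simp: J_def simp flip: distrib_right)
    hence "(\<Sum>j\<in>(UNIV :: 'n set). snd kl j * D + (N - snd kl j) * D) = n * (N * D)"
      by (simp add: n_def)
    moreover have "fst kl \<le> N"
      using that by (auto simp: J_def)
    ultimately have "partial_degrees_le (N * M) (h kl)"
      unfolding h_def using partial_degrees_le_mono[OF partial_degrees_le_mult[OF 1 2]]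
      by (simp add: M_def algebra_simps)
    thus ?thesis
      by (auto simp: partial_degrees_le_def I_def)
  qed
  have relation: "(\<Sum>kl\<in>J. Poly_Mapping.single 0 (c kl) * h kl) = 0"
  proof (rule poly_mapping_eqI)
    fix m
    have "(\<Sum>kl\<in>J. c kl * Poly_Mapping.lookup (h kl) m) = 0"
    proof (cases "m \<in> I")
      case False
      hence "Poly_Mapping.lookup (h kl) m = 0" if "kl \<in> J" for kl
        using keys_h[OF that] by (auto simp: in_keys_iff)
      thus ?thesis by simp
    qed (rule c(2))
    thus "Poly_Mapping.lookup (\<Sum>kl\<in>J. Poly_Mapping.single 0 (c kl) * h kl) m = Poly_Mapping.lookup 0 m"
      by (simp add: lookup_sum lookup_single_zero_mult)
  qed
  have g_fract: "to_fract (g l) = (\<Prod>j\<in>UNIV. f j ^ l j) * to_fract q ^ (N * n)" if "l \<in> B" for l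
  proof -
    have "to_fract (p j ^ l j * q ^ (N - l j)) = f j ^ l j * to_fract q ^ N" for j
    proof -
      have "to_fract (p j ^ l j * q ^ (N - l j)) = f j ^ l j * to_fract q ^ (l j + (N - l j))"
        by (simp add: to_fract_power power_mult_distrib power_add flip: pq(2))
      thus ?thesis
        using B_le[OF that] by simp
    qed
    hence "to_fract (g l) = (\<Prod>j\<in>UNIV. f j ^ l j * to_fract q ^ N)"
      by (simp only: g_def to_fract_prod)
    thus ?thesis
      by (simp add: prod.distrib power_mult n_def)
  qed
  have g_eval: "mpoly_eval (g l) x = (\<Prod>j\<in>UNIV. (F x $ j) ^ l j) * mpoly_eval q x ^ (N * n)"
    if "l \<in> B" for l x
  proof -
    have "mpoly_eval (p j ^ l j * q ^ (N - l j)) x = (F x $ j) ^ l j * mpoly_eval q x ^ N" for j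
    proof -
      have "mpoly_eval (p j ^ l j * q ^ (N - l j)) x = (F x $ j) ^ l j * mpoly_eval q x ^ (l j + (N - l j))"
        by (simp add: power_mult_distrib power_add flip: pq(4))
      thus ?thesis
        using B_le[OF that] by simp
    qed
    hence "mpoly_eval (g l) x = (\<Prod>j\<in>UNIV. (F x $ j) ^ l j * mpoly_eval q x ^ N)"
      by (simp only: g_def mpoly_eval_prod)
    thus ?thesis
      by (simp add: prod.distrib power_mult n_def)
  qed
  \<comment> \<open>The linear relation, sorted by powers of the variable.\<close>
  define P where "P = (\<Sum>(k, l)\<in>J. monom (ratfun_const (c (k, l)) * (\<Prod>j\<in>UNIV. f j ^ l j)) k)"
  note K = subfield_generated_ratfun_subfield[of f]
  show ?thesis
  proof (intro bexI[of _ P] conjI)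
    have "to_fract q \<noteq> 0"
      using pq(1) by simp
    have "poly P ?X * to_fract q ^ (N * n) = to_fract (\<Sum>kl\<in>J. Poly_Mapping.single 0 (c kl) * h kl)"
      unfolding P_def poly_sum sum_distrib_right to_fract_sum
    proof (intro sum.cong refl)
      fix kl assume "kl \<in> J"
      then obtain k l where "kl = (k, l)" "l \<in> B"
        by (auto simp: J_def)
      thus "poly (case kl of (k, l) \<Rightarrow> monom (ratfun_const (c (k, l)) * (\<Prod>j\<in>UNIV. f j ^ l j)) k) ?X *
          to_fract q ^ (N * n) = to_fract (Poly_Mapping.single 0 (c kl) * h kl)"
        by (simp add: poly_monom h_def to_fract_power g_fract ratfun_const_conv_to_fract)
    qed
    thus "poly P ?X = 0"
      unfolding relation using \<open>to_fract q \<noteq> 0\<close> by simp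
  next
    show "P \<in> polys_over (generated_ratfun_subfield f)"
    proof -
      have "f j ^ k \<in> generated_ratfun_subfield f" for j k
        by (induction k) (use subfield_type_ring_closed[OF K] generator_in_generated[of f] in auto)
      hence "(\<Prod>j\<in>S. f j ^ l j) \<in> generated_ratfun_subfield f" for S l
        by (induction S rule: infinite_finite_induct) (use subfield_type_ring_closed[OF K] in auto)
      hence "coeff (monom (ratfun_const (c (k, l)) * (\<Prod>j\<in>UNIV. f j ^ l j)) k) e \<in> generated_ratfun_subfield f"
        for k l e
        using subfield_type_ring_closed[OF K] ratfun_const_in_generated[of _ f] by auto
      thus ?thesis
        unfolding P_def polys_over_def
        by (auto simp: coeff_sum intro!: subfield_type_ring_closed(7)[OF K] split: prod.splits)
    qed
  next
    show "P \<noteq> 0"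
    proof
      assume "P = 0"
      \<comment> \<open>If \<open>P\<close> were zero, its coefficient at this \<open>k\<close>
        would be a nontrivial polynomial relation among the \<open>f j\<close> alone.\<close>
      obtain k l where kl: "k \<le> N" "l \<in> B" "c (k, l) \<noteq> 0"
        using c(1) by (auto simp: J_def)
      have coeff: "(\<Sum>l\<in>B. ratfun_const (c (k, l)) * (\<Prod>j\<in>UNIV. f j ^ l j)) = 0"
      proof -
        have "0 = coeff P k"
          using \<open>P = 0\<close> by simp
        also have "\<dots> = (\<Sum>k'\<le>N. \<Sum>l\<in>B. if k' = k then ratfun_const (c (k', l)) * (\<Prod>j\<in>UNIV. f j ^ l j) else 0)"
          unfolding P_def coeff_sum J_def sum.cartesian_product by (intro sum.cong) auto
        also have "\<dots> = (\<Sum>k'\<le>N. if k' = k then \<Sum>l\<in>B. ratfun_const (c (k', l)) * (\<Prod>j\<in>UNIV. f j ^ l j) else 0)"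
          by (intro sum.cong) auto
        finally show ?thesis
          using kl(1) by simp
      qed
      have "to_fract (\<Sum>l\<in>B. Poly_Mapping.single 0 (c (k, l)) * g l) =
          (\<Sum>l\<in>B. ratfun_const (c (k, l)) * (\<Prod>j\<in>UNIV. f j ^ l j)) * to_fract q ^ (N * n)"
        by (simp add: g_fract sum_distrib_right ratfun_const_conv_to_fract mult.assoc)
      hence zero: "(\<Sum>l\<in>B. Poly_Mapping.single 0 (c (k, l)) * g l) = 0"
        by (simp only: coeff mult_zero_left to_fract_eq_0_iff)
      \<comment> \<open>By surjectivity every \<open>y\<close> is a value of \<open>F\<close>, and
        \<open>q\<close> vanishes nowhere; so the relation holds on all of real n-space and its
        coefficients are zero.\<close>
      have "(\<Sum>l\<in>B. c (k, l) * (\<Prod>j\<in>UNIV. y j ^ l j)) = 0" for y :: "'n \<Rightarrow> real"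
      proof -
        obtain x where x: "F x = (\<chi> j. y j)"
          using surj by (metis surjD)
        have "(\<Sum>l\<in>B. c (k, l) * (\<Prod>j\<in>UNIV. y j ^ l j)) * mpoly_eval q x ^ (N * n) =
            mpoly_eval (\<Sum>l\<in>B. Poly_Mapping.single 0 (c (k, l)) * g l) x"
          by (simp add: g_eval x sum_distrib_right mult.assoc)
        thus ?thesis
          unfolding zero using pq(3)[of x] by simp
      qed
      hence "c (k, l) = 0"
        using kl(2) finB by (intro monomial_functions_independent[of UNIV B "\<lambda>l. c (k, l)" "\<lambda>l. l"]) auto
      thus False
        using kl(3) by simp
    qed
  qed
qed

text \<open>Adjoining the finitely many variables, all algebraic, gives a finite extension; it
  contains the constants, hence all polynomials and their quotients.\<close>

lemma finite_dimension_over_generated: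
  fixes F :: "real ^ 'n::{finite,linorder} \<Rightarrow> real ^ 'n::{finite,linorder}"
  assumes f: "\<forall>i. everywhere_defined_as (f i) (\<lambda>x. F x $ i)" and surj: "surj F"
  shows "ring.finite_dimension type_ring (generated_ratfun_subfield f) UNIV"
proof -
  interpret domain "type_ring :: 'n real_ratfun ring" by (rule type_ring_is_domain)
  note K = subfield_generated_ratfun_subfield[of f]
  obtain vs :: "'n list" where "set vs = UNIV"
    using finite_list[OF finite_class.finite_UNIV] by blast
  define xs where "xs = map (\<lambda>i. to_fract (mpoly_var i)) vs"
  have alg: "(algebraic over generated_ratfun_subfield f) x" if "x \<in> set xs" for x
    using variable_algebraic_over_generated[OF f surj] algebraic_type_ringI that by (fastforce simp: xs_def)
  define E where "E = finite_extension (generated_ratfun_subfield f) xs"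
  have E: "subfield E type_ring"
    unfolding E_def using finite_extension_is_subfield[OF K] alg by simp
  note closed = subfield_type_ring_closed[OF E]
  have const: "ratfun_const c \<in> E" for c
    using finite_extension_incl[OF subfieldE(3)[OF K], of xs] ratfun_const_in_generated unfolding E_def by auto
  have var: "to_fract (mpoly_var i) \<in> E" for i
    using finite_extension_mem[OF subfieldE(1)[OF K], of xs] \<open>set vs = UNIV\<close> by (auto simp: E_def xs_def)
  have "to_fract p \<in> E" for p
  proof -
    have pow: "to_fract (mpoly_var i) ^ k \<in> E" for i k
      by (induction k) (use closed var in auto)
    have "(\<Prod>i\<in>S. to_fract (mpoly_var i) ^ l i) \<in> E" for S and l :: "'n \<Rightarrow> nat"
      by (induction S rule: infinite_finite_induct) (use closed pow in auto)
    hence "to_fract (\<Sum>m\<in>Poly_Mapping.keys p. Poly_Mapping.single 0 (Poly_Mapping.lookup p m) *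
        (\<Prod>i\<in>UNIV. mpoly_var i ^ Poly_Mapping.lookup m i)) \<in> E"
      using const by (auto simp: to_fract_prod to_fract_power simp flip: ratfun_const_conv_to_fract
          intro!: closed(5) subfield_type_ring_closed(7)[OF E])
    thus ?thesis
      by (simp only: mpoly_eq_sum_monomials[symmetric])
  qed
  moreover have "inverse x \<in> E" if "x \<in> E" for x
    using subfield_m_inv(1)[OF E, of x] that closed(1) by (cases "x = 0") auto
  ultimately have "r \<in> E" for r
    by (cases r) (simp add: Fract_conv_to_fract divide_inverse closed)
  hence "E = UNIV"
    by blast
  thus ?thesis
    using finite_extension_finite_dimension(1)[OF K, of xs] alg by (simp add: E_def)
qed

section \<open>Parity of the degree\<close>

theorem corollary38:
  fixes F :: "real ^ 'n::{finite,linorder} \<Rightarrow> real ^ 'n::{finite,linorder}"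
    and f :: "'n \<Rightarrow> 'n real_ratfun"
    and d :: nat
  assumes "\<forall>i. everywhere_defined_as (f i) (\<lambda>x. F x $ i)"
    and "\<forall>x. det (jacobian F (at x)) \<noteq> 0"
    and "d = ratfun_extension_degree f"
    and "bij F"
  shows "odd d"
proof
  assume "even d"
  interpret domain "type_ring :: 'n real_ratfun ring" by (rule type_ring_is_domain)
  note K = subfield_generated_ratfun_subfield[of f]
  \<comment> \<open>Finiteness turns the value of \<open>ring.dim\<close> into an actual
    dimension.\<close>
  have "dimension d (generated_ratfun_subfield f) UNIV"
    using finite_dimensionE[OF K finite_dimension_over_generated[OF assms(1) bij_is_surj[OF assms(4)]]]
    by (simp add: assms(3) ratfun_extension_degree_def ratfun_field_def over_def)
  from eventual_hom_even_degree_not_unique[OF K eventual_hom_ratfun_eval this \<open>even d\<close>]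
  obtain \<tau> a where hom: "eventual_hom zariski_generic UNIV \<tau>"
    and agree: "\<And>e. e \<in> generated_ratfun_subfield f \<Longrightarrow> \<forall>\<^sub>F z in zariski_generic. \<tau> e z = ratfun_eval e z"
    and ne: "\<forall>\<^sub>F z in zariski_generic. \<tau> a z \<noteq> ratfun_eval a z"
    by blast
  have UNIV: "subfield UNIV (type_ring :: 'n real_ratfun ring)"
    using field.carrier_is_subfield[OF type_ring_is_field] by simp
  interpret eventual_field_hom zariski_generic UNIV \<tau>
    by (rule eventual_field_hom.intro[OF UNIV hom])
  \<comment> \<open>Constants lie in the generated subfield, where \<open>\<tau>\<close> agrees with
    evaluation.\<close>
  have const: "\<forall>\<^sub>F z in zariski_generic. \<tau> (ratfun_const c) z = c" for c
    using agree[OF ratfun_const_in_generated[of c f]]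
      eventually_ratfun_eval_Fract[OF one_neq_zero, of "Poly_Mapping.single 0 c"]
    by eventually_elim (simp add: ratfun_const_def)
  define \<xi> where "\<xi> z = (\<chi> i. \<tau> (to_fract (mpoly_var i)) z)" for z
  note eval = eventual_hom_mpoly[OF hom const, folded \<xi>_def]
  obtain p q where pq: "q \<noteq> 0" "\<And>i. f i * to_fract q = to_fract (p i)" "\<And>x. mpoly_eval q x \<noteq> 0"
    "\<And>i x. F x $ i * mpoly_eval q x = mpoly_eval (p i) x"
    by (rule common_denominator[OF assms(1)]) blast
  \<comment> \<open>Apply \<open>\<tau>\<close> to \<open>f i * q = p i\<close>: the first factor
    gives \<open>F z $ i\<close>, the polynomials give their values at \<open>\<xi> z\<close>.
    Cancelling \<open>q\<close> there uses that it vanishes nowhere, since \<open>\<xi> z\<close> is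
    not known to be generic at this stage.\<close>
  have "\<forall>\<^sub>F z in zariski_generic. F (\<xi> z) $ i = F z $ i" for i
  proof -
    have "f i = Fract (p i) q"
      using pq(1,2) by (simp add: Fract_conv_to_fract field_simps)
    from mult[OF UNIV_I UNIV_I, of "f i" "to_fract q"] eval[of q] eval[of "p i"] agree[OF generator_in_generated[of f i]]
      eventually_ratfun_eval_Fract[OF pq(1), of "p i", folded this]
    show ?thesis
    proof eventually_elim
      case (elim z)
      have "mpoly_eval (p i) z / mpoly_eval q z = F z $ i"
        using pq(3)[of z] by (simp flip: pq(4))
      hence "F (\<xi> z) $ i * mpoly_eval q (\<xi> z) = F z $ i * mpoly_eval q (\<xi> z)"
        using elim by (simp add: pq(2,4))
      thus ?case
        using pq(3) by simp
    qed
  qed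
  hence "\<forall>\<^sub>F z in zariski_generic. \<forall>i\<in>UNIV. F (\<xi> z) $ i = F z $ i"
    by (intro eventually_ball_finite) auto
  hence \<xi>: "\<forall>\<^sub>F z in zariski_generic. \<xi> z = z"
    by eventually_elim (use assms(4) in \<open>auto simp: bij_def vec_eq_iff dest: injD\<close>)
  \<comment> \<open>With \<open>\<xi> z = z\<close>, \<open>\<tau>\<close> is evaluation on
    polynomials; the relation \<open>a * c = b\<close> carries this over to the fraction
    \<open>a\<close>.\<close>
  obtain b c where a: "a = Fract b c" "c \<noteq> 0"
    by (cases a)
  have "a * to_fract c = to_fract b"
    using a by (simp add: Fract_conv_to_fract)
  with mult[OF UNIV_I UNIV_I, of a "to_fract c"]
  have "\<forall>\<^sub>F z in zariski_generic. \<tau> (to_fract b) z = \<tau> a z * \<tau> (to_fract c) z"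
    by simp
  with \<xi> eval[of b] eval[of c] eventually_ratfun_eval_Fract[OF a(2), of b, folded a(1)]
    eventually_mpoly_eval_nonzero[OF a(2)]
  have "\<forall>\<^sub>F z in zariski_generic. \<tau> a z = ratfun_eval a z"
  proof eventually_elim
    case (elim z)
    have nz: "mpoly_eval c z \<noteq> 0"
      by fact
    have "\<tau> a z * mpoly_eval c z = ratfun_eval a z * mpoly_eval c z"
      using elim by simp
    thus ?case
      using mult_right_cancel[OF nz] by blast
  qed
  \<comment> \<open>The filter is proper, so the two contradictory generic statements would hold
    together at some point.\<close>
  from eventually_happens'[OF zariski_generic_neq_bot eventually_conj[OF ne this]] show False
    by blast
qed

end
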